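(* Let $n\ge 1$, let $p=(p_{ij})$, $q=(q_{ij})$ satisfy the $(p,\lambda)$ condition, and let $A=(a_{ij})_{1\le i,j\le n}$ be the matrix of generators of $\mathrm{GL}_{p,\lambda}(n)$. In the ring of fractions of $\mathrm{GL}_{p,\lambda}(n)$ one has $${\det}_q(A)=|A|_{11}\,|A^{1,1}|_{22}\,|A^{12,12}|_{33}\cdots a_{nn},$$ and the factors (quasi-minors) on the right-hand side commute with each other. More generally, for any two permutations $\sigma,\tau\in S_n$, $${\det}_q(A)=\frac{(-q)_\tau}{(-q)_\sigma}\,|A|_{\sigma_1\tau_1}\,|A^{\sigma_1,\tau_1}|_{\sigma_2\tau_2}\,|A^{\sigma_1\sigma_2,\tau_1\tau_2}|_{\sigma_3\tau_3}\cdots a_{\sigma_n\tau_n}.$$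
   Context: Parameters: $p=(p_{ij})_{1\le i,j\le n}$ and $q=(q_{ij})_{1\le i,j\le n}$ are matrices of complex numbers with $p_{ij}p_{ji}=1$, $p_{ii}=1$, $q_{ij}q_{ji}=1$, $q_{ii}=1$. The $(p,\lambda)$ condition: there is $\lambda\in\mathbb C$, $\lambda\ne -1$, with $p_{ij}q_{ij}=\lambda$ for all $i<j$. $\mathcal A$ is the unital associative $\mathbb C$-algebra generated by $a_{ij}$, $1\le i,j\le n$, subject to the relations $$a_{ik}a_{il}=q_{kl}a_{il}a_{ik}\quad (k<l,\ \text{all } i),$$ $$a_{ik}a_{jk}=p_{ij}a_{jk}a_{ik}\quad (i<j,\ \text{all } k),$$ and, for $i<j$ and $k<l$, $$a_{ik}a_{jl}-\frac{q_{kl}}{q_{ij}}a_{jl}a_{ik}=q_{kl}a_{il}a_{jk}-\frac{1}{q_{ij}}a_{jk}a_{il},$$ $$a_{ik}a_{jl}-\frac{p_{ij}}{p_{kl}}a_{jl}a_{ik}=p_{ij}a_{jk}a_{il}-\frac{1}{p_{kl}}a_{il}a_{jk}.$$ For $\sigma\in S_n$ put $$(-q)_\sigma=(-1)^{l(\sigma)}\prod_{i<j,\ \sigma_i>\sigma_j}q_{\sigma_j\sigma_i},\qquad (-p)_\sigma=(-1)^{l(\sigma)}\prod_{i<j,\ \sigma_i>\sigma_j}p_{\sigma_j\sigma_i},$$ where $l(\sigma)$ is the number of inversions of $\sigma$. The quantum determinant is $${\det}_q(A)=\sum_{\sigma\in S_n}(-q)_\sigma a_{1,\sigma_1}\cdots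 a_{n,\sigma_n}=\sum_{\sigma\in S_n}(-p)_\sigma a_{\sigma_1,1}\cdots a_{\sigma_n,n}$$ (the two expressions agree under the $(p,\lambda)$ condition). It is a regular element of $\mathcal A$ which commutes with each generator up to a nonzero scalar, and $\mathrm{GL}_{p,\lambda}(n)$ denotes the localization $\mathcal A[{\det}_q(A)^{-1}]$. Computations take place in the ring (skew field) of fractions of $\mathrm{GL}_{p,\lambda}(n)$. Quasideterminants: for a square matrix $X=(x_{ij})_{i\in I,\,j\in J}$ (with $|I|=|J|$) that is invertible over the ring of fractions, with inverse $Y=X^{-1}=(y_{ji})_{j\in J,\,i\in I}$, the $(i,j)$-th quasideterminant is $|X|_{ij}=y_{ji}^{-1}$. For a $1\times1$ matrix, $|X|_{ij}=x_{ij}$. The matrix $X^{i_1\cdots i_r,\,j_1\cdots j_r}$ is the submatrix of $X$ obtained by deleting rows $i_1,\dots,i_r$ and columns $j_1,\dots,j_r$; the remaining rows and columns keep their original labels, and these original labels are used as indices of quasideterminants. In particular the last factors in the two products are $|A^{1\cdots(n-1),\,1\cdots(n-1)}|_{nn}=a_{nn}$ and $|A^{\sigma_1\cdots\sigma_{n-1},\,\tau_1\cdots\tau_{n-1}}|_{\sigma_n\tau_n}=a_{\sigma_n\tau_n}$. *)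

theory Defs
  imports Complex_Main "HOL-Library.Poly_Mapping" "HOL-Combinatorics.Permutations"
    "HOL-Algebra.QuotRing"
begin

section \<open>Free associative algebras over the complex numbers\<close>

text \<open>The library's multiplication on \<^typ>\<open>'m \<Rightarrow>\<^sub>0 'b\<close> is convolution over the additively
  written, not necessarily commutative, monoid \<^typ>\<open>'m\<close>. Over the monoid of words under
  concatenation this is the free associative unital algebra.\<close>

datatype 'x free_word = Free_Word (letters: "'x list")

instantiation free_word :: (type) monoid_add
begin

definition zero_free_word :: "'x free_word" where
  "zero_free_word = Free_Word []"

definition plus_free_word :: "'x free_word \<Rightarrow> 'x free_word \<Rightarrow> 'x free_word" where
  "plus_free_word v w = Free_Word (letters v @ letters w)"

instance
  by standard (simp_all add: zero_free_word_def plus_free_word_def)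

end

definition free_algebra :: "'x set \<Rightarrow> ('x free_word \<Rightarrow>\<^sub>0 complex) ring" where
  "free_algebra S =
     \<lparr>carrier = {f. \<forall>w\<in>Poly_Mapping.keys f. set (letters w) \<subseteq> S},
      mult = (*), one = 1, zero = 0, add = (+)\<rparr>"

definition free_scalar :: "complex \<Rightarrow> 'x free_word \<Rightarrow>\<^sub>0 complex" where
  "free_scalar c = Poly_Mapping.single 0 c"

definition free_gen :: "'x \<Rightarrow> 'x free_word \<Rightarrow>\<^sub>0 complex" where
  "free_gen x = Poly_Mapping.single (Free_Word [x]) 1"


section \<open>The multiparameter quantum matrix algebra\<close>

definition p_lambda_condition ::
  "nat \<Rightarrow> (nat \<Rightarrow> nat \<Rightarrow> complex) \<Rightarrow> (nat \<Rightarrow> nat \<Rightarrow> complex) \<Rightarrow> complex \<Rightarrow> bool" where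
  "p_lambda_condition n p q lam \<longleftrightarrow>
     (\<forall>i\<in>{1..n}. \<forall>j\<in>{1..n}. p i j * p j i = 1 \<and> q i j * q j i = 1) \<and>
     (\<forall>i\<in>{1..n}. p i i = 1 \<and> q i i = 1) \<and>
     lam \<noteq> -1 \<and>
     (\<forall>i\<in>{1..n}. \<forall>j\<in>{1..n}. i < j \<longrightarrow> p i j * q i j = lam)"

text \<open>A relation \<open>l = r\<close> is represented by the element \<open>l - r\<close> of the free algebra.\<close>

definition qmat_relations ::
  "nat \<Rightarrow> (nat \<Rightarrow> nat \<Rightarrow> complex) \<Rightarrow> (nat \<Rightarrow> nat \<Rightarrow> complex)
     \<Rightarrow> ((nat \<times> nat) free_word \<Rightarrow>\<^sub>0 complex) set" where
  "qmat_relations n p q =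
     (let a = (\<lambda>i j. free_gen (i, j)); C = free_scalar in
       {a i k * a i l - C (q k l) * a i l * a i k | i k l.
          i \<in> {1..n} \<and> k \<in> {1..n} \<and> l \<in> {1..n} \<and> k < l}
     \<union> {a i k * a j k - C (p i j) * a j k * a i k | i j k.
          i \<in> {1..n} \<and> j \<in> {1..n} \<and> k \<in> {1..n} \<and> i < j}
     \<union> {(a i k * a j l - C (q k l / q i j) * a j l * a i k)
          - (C (q k l) * a i l * a j k - C (1 / q i j) * a j k * a i l) | i j k l.
          i \<in> {1..n} \<and> j \<in> {1..n} \<and> k \<in> {1..n} \<and> l \<in> {1..n} \<and> i < j \<and> k < l}
     \<union> {(a i k * a j l - C (p i j / p k l) * a j l * a i k)
          - (C (p i j) * a j k * a i l - C (1 / p k l) * a i l * a j k) | i j k l.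
          i \<in> {1..n} \<and> j \<in> {1..n} \<and> k \<in> {1..n} \<and> l \<in> {1..n} \<and> i < j \<and> k < l})"

abbreviation qmat_free :: "nat \<Rightarrow> ((nat \<times> nat) free_word \<Rightarrow>\<^sub>0 complex) ring" where
  "qmat_free n \<equiv> free_algebra ({1..n} \<times> {1..n})"

definition qmat_ideal ::
  "nat \<Rightarrow> (nat \<Rightarrow> nat \<Rightarrow> complex) \<Rightarrow> (nat \<Rightarrow> nat \<Rightarrow> complex)
     \<Rightarrow> ((nat \<times> nat) free_word \<Rightarrow>\<^sub>0 complex) set" where
  "qmat_ideal n p q = Idl\<^bsub>qmat_free n\<^esub> (qmat_relations n p q)"

definition qmat_algebra ::
  "nat \<Rightarrow> (nat \<Rightarrow> nat \<Rightarrow> complex) \<Rightarrow> (nat \<Rightarrow> nat \<Rightarrow> complex)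
     \<Rightarrow> ((nat \<times> nat) free_word \<Rightarrow>\<^sub>0 complex) set ring" where
  "qmat_algebra n p q = qmat_free n Quot qmat_ideal n p q"

definition qmat_gen ::
  "nat \<Rightarrow> (nat \<Rightarrow> nat \<Rightarrow> complex) \<Rightarrow> (nat \<Rightarrow> nat \<Rightarrow> complex)
     \<Rightarrow> nat \<Rightarrow> nat \<Rightarrow> ((nat \<times> nat) free_word \<Rightarrow>\<^sub>0 complex) set" where
  "qmat_gen n p q i j = qmat_ideal n p q +>\<^bsub>qmat_free n\<^esub> free_gen (i, j)"

definition qmat_scalar ::
  "nat \<Rightarrow> (nat \<Rightarrow> nat \<Rightarrow> complex) \<Rightarrow> (nat \<Rightarrow> nat \<Rightarrow> complex)
     \<Rightarrow> complex \<Rightarrow> ((nat \<times> nat) free_word \<Rightarrow>\<^sub>0 complex) set" where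
  "qmat_scalar n p q c = qmat_ideal n p q +>\<^bsub>qmat_free n\<^esub> free_scalar c"


section \<open>The quantum determinant\<close>

definition inversions :: "nat \<Rightarrow> (nat \<Rightarrow> nat) \<Rightarrow> (nat \<times> nat) set" where
  "inversions n \<sigma> = {(i, j). i \<in> {1..n} \<and> j \<in> {1..n} \<and> i < j \<and> \<sigma> i > \<sigma> j}"

text \<open>\<open>neg_weight n q \<sigma>\<close> is the scalar written \<open>(-q)\<^sub>\<sigma>\<close>.\<close>

definition neg_weight :: "nat \<Rightarrow> (nat \<Rightarrow> nat \<Rightarrow> complex) \<Rightarrow> (nat \<Rightarrow> nat) \<Rightarrow> complex" where
  "neg_weight n q \<sigma> =
     (-1) ^ card (inversions n \<sigma>) * (\<Prod>(i, j)\<in>inversions n \<sigma>. q (\<sigma> j) (\<sigma> i))"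

text \<open>The product \<open>f 1 \<otimes> f 2 \<otimes> \<dots> \<otimes> f n\<close>, in this order.\<close>

definition ordered_prod :: "('r, 'm) ring_scheme \<Rightarrow> nat \<Rightarrow> (nat \<Rightarrow> 'r) \<Rightarrow> 'r" where
  "ordered_prod R n f = foldr (mult R) (map f [1..<Suc n]) \<one>\<^bsub>R\<^esub>"

definition qdet ::
  "nat \<Rightarrow> (nat \<Rightarrow> nat \<Rightarrow> complex) \<Rightarrow> (nat \<Rightarrow> nat \<Rightarrow> complex)
     \<Rightarrow> ((nat \<times> nat) free_word \<Rightarrow>\<^sub>0 complex) set" where
  "qdet n p q =
     (\<Oplus>\<^bsub>qmat_algebra n p q\<^esub> \<sigma>\<in>{\<sigma>. \<sigma> permutes {1..n}}.
        qmat_scalar n p q (neg_weight n q \<sigma>) \<otimes>\<^bsub>qmat_algebra n p q\<^esub>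
          ordered_prod (qmat_algebra n p q) n (\<lambda>i. qmat_gen n p q i (\<sigma> i)))"


section \<open>Rings of fractions\<close>

text \<open>Injectivity of \<open>\<phi>\<close> together with invertibility of \<open>\<phi> s\<close> for \<open>s \<in> S\<close> forces the elements
  of \<open>S\<close> to be regular. For multiplicatively closed \<open>S\<close> these conditions determine \<open>(Q, \<phi>)\<close>
  up to unique isomorphism: \<open>Q\<close> is the ring of right fractions \<open>a s\<inverse>\<close>.\<close>

definition ring_of_fractions ::
  "('r, 'm) ring_scheme \<Rightarrow> 'r set \<Rightarrow> ('s, 'k) ring_scheme \<Rightarrow> ('r \<Rightarrow> 's) \<Rightarrow> bool" where
  "ring_of_fractions R S Q \<phi> \<longleftrightarrow>
     ring Q \<and> \<phi> \<in> ring_hom R Q \<and> inj_on \<phi> (carrier R) \<and> \<phi> ` S \<subseteq> Units Q \<and>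
     (\<forall>x\<in>carrier Q. \<exists>a\<in>carrier R. \<exists>s\<in>S. x = \<phi> a \<otimes>\<^bsub>Q\<^esub> inv\<^bsub>Q\<^esub> (\<phi> s))"

definition is_GL ::
  "nat \<Rightarrow> (nat \<Rightarrow> nat \<Rightarrow> complex) \<Rightarrow> (nat \<Rightarrow> nat \<Rightarrow> complex) \<Rightarrow> ('g, 'm) ring_scheme
     \<Rightarrow> (((nat \<times> nat) free_word \<Rightarrow>\<^sub>0 complex) set \<Rightarrow> 'g) \<Rightarrow> bool" where
  "is_GL n p q GL \<phi> \<longleftrightarrow>
     ring_of_fractions (qmat_algebra n p q)
       (range (\<lambda>k::nat. qdet n p q [^]\<^bsub>qmat_algebra n p q\<^esub> k)) GL \<phi>"

definition skew_field :: "('r, 'm) ring_scheme \<Rightarrow> bool" where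
  "skew_field D \<longleftrightarrow> ring D \<and> \<one>\<^bsub>D\<^esub> \<noteq> \<zero>\<^bsub>D\<^esub> \<and> Units D = carrier D - {\<zero>\<^bsub>D\<^esub>}"

definition is_skew_field_of_fractions ::
  "('r, 'm) ring_scheme \<Rightarrow> ('s, 'k) ring_scheme \<Rightarrow> ('r \<Rightarrow> 's) \<Rightarrow> bool" where
  "is_skew_field_of_fractions R D \<psi> \<longleftrightarrow>
     skew_field D \<and> ring_of_fractions R (carrier R - {\<zero>\<^bsub>R\<^esub>}) D \<psi>"


section \<open>Quasideterminants\<close>

text \<open>Matrices are functions \<open>X\<close> of a row and a column label, read only on the row labels \<open>I\<close> and
  the column labels \<open>J\<close>. Deleting rows and columns shrinks \<open>I\<close> and \<open>J\<close> and keeps the labels of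
  the others.\<close>

definition is_matrix_inverse ::
  "('r, 'm) ring_scheme \<Rightarrow> nat set \<Rightarrow> nat set \<Rightarrow> (nat \<Rightarrow> nat \<Rightarrow> 'r) \<Rightarrow> (nat \<Rightarrow> nat \<Rightarrow> 'r) \<Rightarrow> bool"
  where
  "is_matrix_inverse R I J X Y \<longleftrightarrow>
     (\<forall>j\<in>J. \<forall>i\<in>I. Y j i \<in> carrier R) \<and>
     (\<forall>i\<in>I. \<forall>i'\<in>I. (\<Oplus>\<^bsub>R\<^esub> j\<in>J. X i j \<otimes>\<^bsub>R\<^esub> Y j i') = (if i = i' then \<one>\<^bsub>R\<^esub> else \<zero>\<^bsub>R\<^esub>)) \<and>
     (\<forall>j\<in>J. \<forall>j'\<in>J. (\<Oplus>\<^bsub>R\<^esub> i\<in>I. Y j i \<otimes>\<^bsub>R\<^esub> X i j') = (if j = j' then \<one>\<^bsub>R\<^esub> else \<zero>\<^bsub>R\<^esub>))"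

definition quasidet_defined ::
  "('r, 'm) ring_scheme \<Rightarrow> nat set \<Rightarrow> nat set \<Rightarrow> (nat \<Rightarrow> nat \<Rightarrow> 'r) \<Rightarrow> nat \<Rightarrow> nat \<Rightarrow> bool" where
  "quasidet_defined R I J X i j \<longleftrightarrow>
     (I = {i} \<and> J = {j}) \<or> (\<exists>Y. is_matrix_inverse R I J X Y \<and> Y j i \<in> Units R)"

text \<open>The inverse of a matrix is unique on the relevant labels, so the choice is immaterial.\<close>

definition quasidet ::
  "('r, 'm) ring_scheme \<Rightarrow> nat set \<Rightarrow> nat set \<Rightarrow> (nat \<Rightarrow> nat \<Rightarrow> 'r) \<Rightarrow> nat \<Rightarrow> nat \<Rightarrow> 'r" where
  "quasidet R I J X i j =
     (if I = {i} \<and> J = {j} then X i j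
      else inv\<^bsub>R\<^esub> ((SOME Y. is_matrix_inverse R I J X Y) j i))"

text \<open>The \<open>k\<close>-th factor: rows \<open>\<sigma> 1, \<dots>, \<sigma> (k-1)\<close> and columns \<open>\<tau> 1, \<dots>, \<tau> (k-1)\<close> are deleted
  from the \<open>n \<times> n\<close> matrix \<open>X\<close>, and the quasideterminant at \<open>(\<sigma> k, \<tau> k)\<close> is taken.\<close>

definition quasi_minor_defined ::
  "('r, 'm) ring_scheme \<Rightarrow> nat \<Rightarrow> (nat \<Rightarrow> nat \<Rightarrow> 'r) \<Rightarrow> (nat \<Rightarrow> nat) \<Rightarrow> (nat \<Rightarrow> nat) \<Rightarrow> nat \<Rightarrow> bool"
  where
  "quasi_minor_defined R n X \<sigma> \<tau> k \<longleftrightarrow>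
     quasidet_defined R ({1..n} - \<sigma> ` {1..<k}) ({1..n} - \<tau> ` {1..<k}) X (\<sigma> k) (\<tau> k)"

definition quasi_minor ::
  "('r, 'm) ring_scheme \<Rightarrow> nat \<Rightarrow> (nat \<Rightarrow> nat \<Rightarrow> 'r) \<Rightarrow> (nat \<Rightarrow> nat) \<Rightarrow> (nat \<Rightarrow> nat) \<Rightarrow> nat \<Rightarrow> 'r"
  where
  "quasi_minor R n X \<sigma> \<tau> k =
     quasidet R ({1..n} - \<sigma> ` {1..<k}) ({1..n} - \<tau> ` {1..<k}) X (\<sigma> k) (\<tau> k)"

end

theory Submission
  imports Defs "HOL-Combinatorics.Multiset_Permutations"
begin

text \<open>
  Let \<open>\<xi>\<^sub>1, \<dots>, \<xi>\<^sub>n\<close> generate the quantum exterior algebra with \<open>\<xi>\<^sub>j\<^sup>2 = 0\<close> and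
  \<open>\<xi>\<^sub>k \<xi>\<^sub>j = - q\<^sub>j\<^sub>k \<xi>\<^sub>j \<xi>\<^sub>k\<close> for \<open>j < k\<close>, and let the \<open>\<xi>\<^sub>j\<close> commute with the \<open>a\<^sub>i\<^sub>j\<close>. The relations
  between the entries of one row, together with the first of the two long relations, say exactly that
  the elements \<open>x\<^sub>i = \<Sum>\<^sub>j a\<^sub>i\<^sub>j \<xi>\<^sub>j\<close> satisfy the relations of the \<open>\<xi>\<^sub>i\<close> again. Reading off coefficients in
  \<open>x\<^sub>i\<^sub>1 \<cdots> x\<^sub>i\<^sub>r = \<Sum>\<^sub>J [I, J] \<xi>\<^sub>J\<close> defines the minors \<open>[I, J]\<close>, the quantum determinant being
  \<open>[{1..n}, {1..n}]\<close>. Multiplying \<open>x\<^sub>I\<^sub>-\<^sub>i\<close> by one more \<open>x\<^sub>i\<^sub>'\<close> on the left gives either a scalar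
  multiple of \<open>x\<^sub>I\<close> or \<open>0\<close>; in coordinates these are the Laplace expansions along a row together
  with the vanishing of the expansions along a wrong row (\<open>row_expansion\<close>). So the matrix of
  complementary minors, with suitable scalars, divided by \<open>[I, J]\<close> on the right, is a right inverse
  of the submatrix with rows \<open>I\<close> and columns \<open>J\<close>.

  The relations between the entries of one column and the second long relation do the same for \<open>y\<^sub>j = \<Sum>\<^sub>i \<eta>\<^sub>i a\<^sub>i\<^sub>j\<close>, now with the generators \<open>a\<^sub>i\<^sub>j\<close> on the
  right of the minors (\<open>col_expansion\<close>), and this produces a left inverse. Both families of minors
  agree (\<open>row_minor_cong_col_minor\<close>): subtracting the two long relations and dividing by
  \<open>\<lambda> + 1 \<noteq> 0\<close> shows that \<open>a\<^sub>i\<^sub>l\<close> and \<open>a\<^sub>j\<^sub>k\<close> with \<open>i < j\<close>, \<open>k < l\<close> commute up to a scalar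
  (\<open>cross_relation\<close>), and with this the expansion along the first row can be compared with the one
  along the last column.

  A left and a right inverse coincide. Hence the quasideterminant of the submatrix at \<open>(i, j)\<close> is, up
  to an explicit scalar, the quotient \<open>[I, J] [I - i, J - j]\<inverse>\<close> (\<open>quasidet_eq\<close>). In the products of
  quasi-minors neighbouring minors cancel, the scalars multiply up to \<open>(-q)\<^sub>\<sigma> / (-q)\<^sub>\<tau>\<close>, and only the
  quantum determinant is left (\<open>product_of_quasi_minors\<close>). The equality of the two inverses contains more:
  \<open>[I, I]\<close> commutes with \<open>a\<^sub>i\<^sub>j\<close>, for \<open>i, j \<in> I\<close>, up to a scalar of the form \<open>r\<^sub>j / r\<^sub>i\<close>. These
  scalars cancel in every principal minor inside \<open>I\<close>, so principal minors of nested index sets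
  commute, and therefore so do the quasi-minors for \<open>\<sigma> = \<tau> = id\<close>.

  Dividing by minors requires that they are nonzero in the skew field, that is, that they do not lie in
  the ideal of relations. Sending the generators to a monomial matrix, whose nonzero entries sit at
  the positions matching \<open>I\<close> increasingly with \<open>J\<close> and commute up to scalars, respects all relations
  and sends \<open>[I, J]\<close> to a nonzero monomial (\<open>row_minor_notin_N\<close>).

  The minors are elements of the free algebra, where sums and products are those of a type class, and
  identities between them hold modulo the ideal; they are carried over to the skew field by the
  canonical homomorphism only at the end.
\<close>

section \<open>Coactions on a quantum exterior algebra\<close>

text \<open>The coefficient of \<open>\<xi>\<^sub>J\<close> in a product of two elements \<open>x\<^sub>i x\<^sub>i\<^sub>'\<close> is a sum over ordered pairs, while the
  relations concern unordered ones. Adding the sum to its transpose pairs the summands up, and the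
  factor \<open>2\<close> is invertible.\<close>

lemma (in vector_space) antisymmetric_double_sum_mem:
  fixes G :: "'i \<Rightarrow> 'i \<Rightarrow> 'b"
  assumes "finite J" and N: "subspace N" and two: "(2::'a) \<noteq> 0"
    and G: "\<And>j k. j \<in> J \<Longrightarrow> k \<in> J \<Longrightarrow> j \<noteq> k \<Longrightarrow> G j k + G k j \<in> N"
  shows "(\<Sum>j\<in>J. \<Sum>k\<in>J - {j}. G j k) \<in> N"
proof -
  let ?T = "\<Sum>j\<in>J. \<Sum>k\<in>J - {j}. G j k"
  have restrict: "(\<Sum>k\<in>J - {j}. H k) = (\<Sum>k | k \<in> J \<and> k \<noteq> j. H k)" for H :: "'i \<Rightarrow> 'b" and j
    by (rule sum.cong) auto
  have "?T = (\<Sum>j\<in>J. \<Sum>k | k \<in> J \<and> k \<noteq> j. G j k)"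
    by (simp add: restrict)
  also have "\<dots> = (\<Sum>k\<in>J. \<Sum>j | j \<in> J \<and> k \<noteq> j. G j k)"
    by (rule sum.swap_restrict) (use assms in auto)
  also have "\<dots> = (\<Sum>k\<in>J. \<Sum>j\<in>J - {k}. G j k)"
    by (intro sum.cong) auto
  finally have "?T + ?T = (\<Sum>j\<in>J. \<Sum>k\<in>J - {j}. G j k + G k j)"
    by (simp add: sum.distrib)
  moreover have "(\<Sum>j\<in>J. \<Sum>k\<in>J - {j}. G j k + G k j) \<in> N"
    by (intro subspace_sum N G) auto
  ultimately have "scale 2 ?T \<in> N"
    using scale_left_distrib[of 1 1 ?T] by simp
  then have "scale (1 / 2) (scale 2 ?T) \<in> N"
    by (rule subspace_scale[OF N])
  then show ?thesis
    using two by simp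
qed

text \<open>With \<open>\<xi>\<^sub>j \<xi>\<^sub>k = c j k \<xi>\<^sub>{\<^sub>j\<^sub>,\<^sub>k\<^sub>}\<close>, this is the scalar in \<open>\<xi>\<^sub>j \<xi>\<^sub>K = index_weight c j K \<xi>\<^sub>K\<^sub>\<union>\<^sub>{\<^sub>j\<^sub>}\<close>.\<close>

definition index_weight :: "(nat \<Rightarrow> nat \<Rightarrow> complex) \<Rightarrow> nat \<Rightarrow> nat set \<Rightarrow> complex" where
  "index_weight c j K = (\<Prod>k\<in>K. c j k)"

lemma index_weight_remove:
  "finite J \<Longrightarrow> k \<in> J \<Longrightarrow> index_weight c j J = c j k * index_weight c j (J - {k})"
  unfolding index_weight_def by (rule prod.remove)

text \<open>The operators \<open>A i j\<close> stand for multiplication by the generator \<open>a\<^sub>i\<^sub>j\<close>, on the left when rows are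
  treated and, with the indices exchanged, on the right when columns are treated. This lets one
  development serve both sides. The set \<open>N\<close> collects what counts as zero, and the relations are
  required on \<open>W\<close> alone, because the ideal of relations absorbs products with elements over the
  alphabet of generators only. The last two assumptions say that \<open>x\<^sub>i = \<Sum>\<^sub>j A i j \<xi>\<^sub>j\<close> satisfies
  \<open>x\<^sub>i\<^sup>2 = 0\<close> and \<open>c i' i x\<^sub>i x\<^sub>i\<^sub>' = c i i' x\<^sub>i\<^sub>' x\<^sub>i\<close>, coefficient by coefficient.\<close>

locale exterior_coaction = vector_space scale
  for scale :: "complex \<Rightarrow> 'v::ab_group_add \<Rightarrow> 'v" +
  fixes A :: "nat \<Rightarrow> nat \<Rightarrow> 'v \<Rightarrow> 'v"
    and W N :: "'v set" and c :: "nat \<Rightarrow> nat \<Rightarrow> complex" and S :: "nat set"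
  assumes A_add: "A i j (x + y) = A i j x + A i j y"
    and A_scale: "A i j (scale z x) = scale z (A i j x)"
    and W: "subspace W" and N: "subspace N"
    and A_W: "i \<in> S \<Longrightarrow> j \<in> S \<Longrightarrow> x \<in> W \<Longrightarrow> A i j x \<in> W"
    and A_N: "i \<in> S \<Longrightarrow> j \<in> S \<Longrightarrow> x \<in> N \<Longrightarrow> A i j x \<in> N"
    and c_nz: "i \<in> S \<Longrightarrow> j \<in> S \<Longrightarrow> c i j \<noteq> 0"
    and fin_S: "finite S"
    and same_row_less: "i \<in> S \<Longrightarrow> j \<in> S \<Longrightarrow> k \<in> S \<Longrightarrow> j < k \<Longrightarrow> v \<in> W \<Longrightarrow>
      scale (c j k) (A i j (A i k v)) + scale (c k j) (A i k (A i j v)) \<in> N"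
    and two_rows_less: "i \<in> S \<Longrightarrow> i' \<in> S \<Longrightarrow> i < i' \<Longrightarrow> j \<in> S \<Longrightarrow> k \<in> S \<Longrightarrow> j < k \<Longrightarrow> v \<in> W \<Longrightarrow>
      scale (c i' i) (scale (c j k) (A i j (A i' k v)) + scale (c k j) (A i k (A i' j v)))
      - scale (c i i') (scale (c j k) (A i' j (A i k v)) + scale (c k j) (A i' k (A i j v))) \<in> N"
begin

lemma A_0: "A i j 0 = 0"
  using A_add[of i j 0 0] by simp

lemma A_diff: "A i j (x - y) = A i j x - A i j y"
  using A_add[of i j "x - y" y] by simp

lemma A_sum: "A i j (\<Sum>x\<in>T. f x) = (\<Sum>x\<in>T. A i j (f x))"
  by (induction T rule: infinite_finite_induct) (simp_all add: A_0 A_add)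

text \<open>A function \<open>F\<close> on index sets represents \<open>\<Sum>\<^sub>J F J \<xi>\<^sub>J\<close>, and \<open>X i\<close> is multiplication by \<open>x\<^sub>i\<close> on the side on
  which the operators \<open>A i j\<close> multiply.\<close>

definition X :: "nat \<Rightarrow> (nat set \<Rightarrow> 'v) \<Rightarrow> nat set \<Rightarrow> 'v" where
  "X i F J = (\<Sum>j\<in>J. scale (index_weight c j (J - {j})) (A i j (F (J - {j}))))"

text \<open>The coefficient of \<open>\<xi>\<^sub>J\<close> in \<open>x\<^sub>i\<^sub>1 \<cdots> x\<^sub>i\<^sub>r u\<close>.\<close>

definition minor :: "nat list \<Rightarrow> 'v \<Rightarrow> nat set \<Rightarrow> 'v" where
  "minor is u = foldr X is (\<lambda>J. if J = {} then u else 0)"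

lemma minor_Nil: "minor [] u J = (if J = {} then u else 0)"
  and minor_Cons: "minor (i # is) u = X i (minor is u)"
  by (simp_all add: minor_def)

lemma X_scale: "X i (\<lambda>J. scale z (F J)) J = scale z (X i F J)"
  by (simp add: X_def A_scale scale_sum_right mult.commute)

lemma X_diff: "X i (\<lambda>J. F J - G J) J = X i F J - X i G J"
  by (simp add: X_def A_diff scale_right_diff_distrib sum_subtractf)

lemma X_mem:
  assumes "i \<in> S" "J \<subseteq> S" and U: "subspace U"
    and "\<And>i j x. i \<in> S \<Longrightarrow> j \<in> S \<Longrightarrow> x \<in> U \<Longrightarrow> A i j x \<in> U"
    and "\<And>K. K \<subseteq> S \<Longrightarrow> F K \<in> U"
  shows "X i F J \<in> U"
  unfolding X_def by (intro subspace_sum subspace_scale U assms) (use assms(2) in auto)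

lemma X_W: "i \<in> S \<Longrightarrow> J \<subseteq> S \<Longrightarrow> (\<And>K. K \<subseteq> S \<Longrightarrow> F K \<in> W) \<Longrightarrow> X i F J \<in> W"
  by (rule X_mem[OF _ _ W]) (auto intro: A_W)

lemma X_N: "i \<in> S \<Longrightarrow> J \<subseteq> S \<Longrightarrow> (\<And>K. K \<subseteq> S \<Longrightarrow> F K \<in> N) \<Longrightarrow> X i F J \<in> N"
  by (rule X_mem[OF _ _ N]) (auto intro: A_N)

lemma minor_W: "set is \<subseteq> S \<Longrightarrow> J \<subseteq> S \<Longrightarrow> u \<in> W \<Longrightarrow> minor is u J \<in> W"
proof (induction "is" arbitrary: J)
  case Nil
  then show ?case by (simp add: minor_Nil subspace_0[OF W])
next
  case (Cons i "is")
  then show ?case by (auto simp: minor_Cons intro: X_W)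
qed

lemma X_X:
  assumes "finite J"
  shows "X i (X i' F) J = (\<Sum>j\<in>J. \<Sum>k\<in>J - {j}.
    scale (index_weight c j (J - {j} - {k}) * index_weight c k (J - {j} - {k}) * c j k)
      (A i j (A i' k (F (J - {j} - {k})))))"
  unfolding X_def
proof (rule sum.cong[OF refl])
  fix j assume "j \<in> J"
  have "scale (index_weight c j (J - {j})) (A i j (\<Sum>k\<in>J - {j}.
            scale (index_weight c k (J - {j} - {k})) (A i' k (F (J - {j} - {k})))))
     = (\<Sum>k\<in>J - {j}. scale (index_weight c j (J - {j}) * index_weight c k (J - {j} - {k}))
         (A i j (A i' k (F (J - {j} - {k})))))"
    by (simp add: A_sum scale_sum_right A_scale)
  also have "\<dots> = (\<Sum>k\<in>J - {j}.
    scale (index_weight c j (J - {j} - {k}) * index_weight c k (J - {j} - {k}) * c j k)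
      (A i j (A i' k (F (J - {j} - {k})))))"
  proof (rule sum.cong[OF refl])
    fix k assume "k \<in> J - {j}"
    then have "index_weight c j (J - {j}) = c j k * index_weight c j (J - {j} - {k})"
      using assms by (intro index_weight_remove) auto
    then show "scale (index_weight c j (J - {j}) * index_weight c k (J - {j} - {k}))
         (A i j (A i' k (F (J - {j} - {k})))) =
      scale (index_weight c j (J - {j} - {k}) * index_weight c k (J - {j} - {k}) * c j k)
      (A i j (A i' k (F (J - {j} - {k}))))"
      by (simp only: mult_ac)
  qed
  finally show "scale (index_weight c j (J - {j})) (A i j (\<Sum>k\<in>J - {j}.
            scale (index_weight c k (J - {j} - {k})) (A i' k (F (J - {j} - {k})))))
     = (\<Sum>k\<in>J - {j}.
    scale (index_weight c j (J - {j} - {k}) * index_weight c k (J - {j} - {k}) * c j k)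
      (A i j (A i' k (F (J - {j} - {k})))))" .
qed

lemma same_row:
  assumes "i \<in> S" "j \<in> S" "k \<in> S" "j \<noteq> k" "v \<in> W"
  shows "scale (c j k) (A i j (A i k v)) + scale (c k j) (A i k (A i j v)) \<in> N"
  using same_row_less[of i j k v] same_row_less[of i k j v] assms
  by (cases "j < k") (auto simp: add.commute)

lemma two_rows:
  assumes "i \<in> S" "i' \<in> S" "i \<noteq> i'" "j \<in> S" "k \<in> S" "j \<noteq> k" "v \<in> W"
  shows "scale (c i' i) (scale (c j k) (A i j (A i' k v)) + scale (c k j) (A i k (A i' j v)))
      - scale (c i i') (scale (c j k) (A i' j (A i k v)) + scale (c k j) (A i' k (A i j v))) \<in> N"
proof -
  have main: "scale (c i' i) (scale (c j k) (A i j (A i' k v)) + scale (c k j) (A i k (A i' j v)))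
      - scale (c i i') (scale (c j k) (A i' j (A i k v)) + scale (c k j) (A i' k (A i j v))) \<in> N"
    if "i \<in> S" "i' \<in> S" "i < i'" for i i'
    using two_rows_less[of i i' j k v] two_rows_less[of i i' k j v] assms that
    by (cases "j < k") (auto simp: add.commute)
  show ?thesis
    using main[of i i'] subspace_neg[OF N main[of i' i]] assms by (cases "i < i'") auto
qed

lemma X_square:
  assumes "i \<in> S" "J \<subseteq> S" and F: "\<And>K. K \<subseteq> S \<Longrightarrow> F K \<in> W"
  shows "X i (X i F) J \<in> N"
proof -
  have fin: "finite J"
    using assms fin_S finite_subset by blast
  show ?thesis
    unfolding X_X[OF fin]
  proof (rule antisymmetric_double_sum_mem[OF fin N])
    fix j k assume jk: "j \<in> J" "k \<in> J" "j \<noteq> k"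
    let ?K = "J - {j} - {k}"
    have K: "J - {k} - {j} = ?K" by auto
    have "scale (index_weight c j ?K * index_weight c k ?K)
       (scale (c j k) (A i j (A i k (F ?K))) + scale (c k j) (A i k (A i j (F ?K)))) \<in> N"
      by (intro subspace_scale[OF N] same_row F) (use jk assms in auto)
    then show "scale (index_weight c j ?K * index_weight c k ?K * c j k) (A i j (A i k (F ?K))) +
       scale (index_weight c k (J - {k} - {j}) * index_weight c j (J - {k} - {j}) * c k j)
         (A i k (A i j (F (J - {k} - {j})))) \<in> N"
      by (simp add: K scale_right_distrib mult_ac)
  qed simp
qed

lemma X_swap:
  assumes "i \<in> S" "i' \<in> S" "i \<noteq> i'" "J \<subseteq> S" and F: "\<And>K. K \<subseteq> S \<Longrightarrow> F K \<in> W"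
  shows "scale (c i' i) (X i (X i' F) J) - scale (c i i') (X i' (X i F) J) \<in> N"
proof -
  have fin: "finite J"
    using assms fin_S finite_subset by blast
  define G where "G j k =
     scale (c i' i) (scale (index_weight c j (J - {j} - {k}) * index_weight c k (J - {j} - {k}) * c j k)
      (A i j (A i' k (F (J - {j} - {k}))))) -
     scale (c i i') (scale (index_weight c j (J - {j} - {k}) * index_weight c k (J - {j} - {k}) * c j k)
      (A i' j (A i k (F (J - {j} - {k})))))" for j k
  have "scale (c i' i) (X i (X i' F) J) - scale (c i i') (X i' (X i F) J)
      = (\<Sum>j\<in>J. \<Sum>k\<in>J - {j}. G j k)"
    unfolding X_X[OF fin] G_def by (simp only: scale_sum_right sum_subtractf)
  also have "\<dots> \<in> N"
  proof (rule antisymmetric_double_sum_mem[OF fin N])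
    fix j k assume jk: "j \<in> J" "k \<in> J" "j \<noteq> k"
    let ?K = "J - {j} - {k}"
    have K: "J - {k} - {j} = ?K" by auto
    have "scale (index_weight c j ?K * index_weight c k ?K)
       (scale (c i' i) (scale (c j k) (A i j (A i' k (F ?K))) + scale (c k j) (A i k (A i' j (F ?K))))
      - scale (c i i') (scale (c j k) (A i' j (A i k (F ?K))) + scale (c k j) (A i' k (A i j (F ?K))))) \<in> N"
      by (intro subspace_scale[OF N] two_rows F) (use jk assms in auto)
    then show "G j k + G k j \<in> N"
      by (simp add: G_def K scale_right_distrib scale_right_diff_distrib algebra_simps)
  qed simp
  finally show ?thesis .
qed

text \<open>The factor \<open>x\<^sub>i\<close> is moved through the product until it meets its second occurrence, and
  \<open>x\<^sub>i\<^sup>2 = 0\<close>. This is the vanishing of an expansion along a wrong row.\<close>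

lemma X_minor_repeated:
  assumes "i \<in> set is" "set is \<subseteq> S" "J \<subseteq> S" "u \<in> W"
  shows "X i (minor is u) J \<in> N"
  using assms(1,2,3)
proof (induction "is" arbitrary: J)
  case (Cons k ks)
  have MW: "minor ks u K \<in> W" if "K \<subseteq> S" for K
    using minor_W Cons.prems that assms(4) by auto
  show ?case
  proof (cases "i = k")
    case True
    then show ?thesis
      unfolding minor_Cons using Cons.prems MW by (auto intro!: X_square)
  next
    case False
    then have sub: "X i (minor ks u) K \<in> N" if "K \<subseteq> S" for K
      using Cons.IH[of K] Cons.prems that by auto
    have "X k (X i (minor ks u)) J \<in> N"
      by (rule X_N) (use Cons.prems sub in auto)
    then have "scale (c i k) (X k (X i (minor ks u)) J) \<in> N"
      by (rule subspace_scale[OF N])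
    moreover have "scale (c k i) (X i (X k (minor ks u)) J)
        - scale (c i k) (X k (X i (minor ks u)) J) \<in> N"
      using Cons.prems False MW by (intro X_swap) auto
    ultimately have "scale (c k i) (X i (X k (minor ks u)) J) \<in> N"
      using subspace_add[OF N] by fastforce
    then have "scale (1 / c k i) (scale (c k i) (X i (X k (minor ks u)) J)) \<in> N"
      by (rule subspace_scale[OF N])
    moreover have "c k i \<noteq> 0"
      using c_nz Cons.prems by auto
    ultimately show ?thesis
      by (simp add: minor_Cons)
  qed
qed simp

text \<open>Moving \<open>x\<^sub>i\<close> past \<open>x\<^sub>k\<close> costs the factor \<open>c i k / c k i\<close>, which is stated here without division.\<close>

lemma X_minor_insert:
  assumes "set us \<subseteq> S" "set vs \<subseteq> S" "i \<in> S" "i \<notin> set us" "J \<subseteq> S" "u \<in> W"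
  shows "scale (prod_list (map (\<lambda>k. c k i) us)) (X i (minor (us @ vs) u) J)
       - scale (prod_list (map (\<lambda>k. c i k) us)) (minor (us @ i # vs) u J) \<in> N"
  using assms(1,4,5)
proof (induction us arbitrary: J)
  case Nil
  then show ?case by (simp add: minor_Cons subspace_0[OF N])
next
  case (Cons k us)
  let ?a = "prod_list (map (\<lambda>k. c k i) us)" and ?b = "prod_list (map (\<lambda>k. c i k) us)"
  let ?F = "minor (us @ vs) u"
  have MW: "?F K \<in> W" if "K \<subseteq> S" for K
    using minor_W[of "us @ vs"] Cons.prems that assms by auto
  have "scale (c k i) (X i (X k ?F) J) - scale (c i k) (X k (X i ?F) J) \<in> N"
    using Cons.prems MW assms by (intro X_swap) auto
  then have 1: "scale ?a (scale (c k i) (X i (X k ?F) J) - scale (c i k) (X k (X i ?F) J)) \<in> N"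
    by (rule subspace_scale[OF N])
  have "X k (\<lambda>J. scale ?a (X i ?F J) - scale ?b (minor (us @ i # vs) u J)) J \<in> N"
    by (rule X_N) (use Cons in auto)
  then have 2: "scale (c i k) (scale ?a (X k (X i ?F) J) - scale ?b (X k (minor (us @ i # vs) u) J)) \<in> N"
    using X_diff X_scale by (intro subspace_scale[OF N]) simp
  from subspace_add[OF N 1 2] show ?case
    by (simp add: minor_Cons scale_right_diff_distrib mult_ac)
qed

text \<open>For a list along which \<open>c\<close> is normalised to \<open>1\<close> the scalar is the one by which \<open>\<xi>\<^sub>i\<close> is inserted
  into \<open>\<xi>\<^sub>I\<^sub>-\<^sub>i\<close>: the \<open>x\<^sub>i\<close> behave exactly like the \<open>\<xi>\<^sub>i\<close>. This is the Laplace expansion.\<close>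

lemma X_minor_sorted:
  assumes "sorted_wrt (\<lambda>i k. c i k = 1) is" "distinct is" "set is \<subseteq> S" "i \<in> set is" "J \<subseteq> S" "u \<in> W"
  shows "X i (minor (remove1 i is) u) J - scale (index_weight c i (set is - {i})) (minor is u J) \<in> N"
proof -
  obtain us vs where uv: "is = us @ i # vs"
    using assms(4) split_list by metis
  have [simp]: "i \<notin> set us" "i \<notin> set vs"
    using uv assms(2) by auto
  have "map (\<lambda>k. c k i) us = map (\<lambda>_. 1) us"
    using assms(1) by (auto simp: uv sorted_wrt_append)
  then have l: "prod_list (map (\<lambda>k. c k i) us) = 1"
    by (simp add: map_replicate_const)
  have "index_weight c i (set is - {i}) = (\<Prod>k\<in>set us \<union> set vs. c i k)"
    unfolding index_weight_def uv by (rule prod.cong) auto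
  also have "\<dots> = (\<Prod>k\<in>set us. c i k) * (\<Prod>k\<in>set vs. c i k)"
    by (rule prod.union_disjoint) (use assms(2) in \<open>auto simp: uv\<close>)
  also have "(\<Prod>k\<in>set vs. c i k) = 1"
    by (rule prod.neutral) (use assms(1) in \<open>auto simp: uv sorted_wrt_append\<close>)
  also have "(\<Prod>k\<in>set us. c i k) = prod_list (map (c i) us)"
    by (rule prod.distinct_set_conv_list) (use assms(2) in \<open>auto simp: uv\<close>)
  finally have "prod_list (map (\<lambda>k. c i k) us) = index_weight c i (set is - {i})"
    by simp
  then show ?thesis
    using X_minor_insert[of us vs i J u] assms l by (auto simp: uv remove1_append)
qed

end

section \<open>The free algebra\<close>

lemma poly_mapping_eq_sum_single:
  "f = (\<Sum>w\<in>Poly_Mapping.keys f. Poly_Mapping.single w (Poly_Mapping.lookup f w))"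
  by (rule poly_mapping_eqI)
    (auto simp: lookup_sum lookup_single when_def in_keys_iff)

lemma carrier_free_algebra:
  "f \<in> carrier (free_algebra S) \<longleftrightarrow> (\<forall>w\<in>Poly_Mapping.keys f. set (letters w) \<subseteq> S)"
  by (simp add: free_algebra_def)

lemma free_algebra_simps [simp]:
  "mult (free_algebra S) = (*)" "one (free_algebra S) = 1"
  "zero (free_algebra S) = 0" "add (free_algebra S) = (+)"
  by (simp_all add: free_algebra_def)

lemma free_algebra_0 [simp]: "0 \<in> carrier (free_algebra S)"
  and free_algebra_1 [simp]: "1 \<in> carrier (free_algebra S)"
  and free_algebra_scalar [simp]: "free_scalar z \<in> carrier (free_algebra S)"
  and free_algebra_gen: "x \<in> S \<Longrightarrow> free_gen x \<in> carrier (free_algebra S)"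
  by (auto simp: carrier_free_algebra free_scalar_def free_gen_def zero_free_word_def
      simp flip: single_one split: if_splits)

lemma free_algebra_add:
  assumes "f \<in> carrier (free_algebra S)" "g \<in> carrier (free_algebra S)"
  shows "f + g \<in> carrier (free_algebra S)"
  using assms keys_add[of f g] by (auto simp: carrier_free_algebra)

lemma free_algebra_uminus:
  "f \<in> carrier (free_algebra S) \<Longrightarrow> - f \<in> carrier (free_algebra S)"
  by (auto simp: carrier_free_algebra)

lemma free_algebra_mult:
  assumes "f \<in> carrier (free_algebra S)" "g \<in> carrier (free_algebra S)"
  shows "f * g \<in> carrier (free_algebra S)"
  unfolding carrier_free_algebra
proof
  fix w assume "w \<in> Poly_Mapping.keys (f * g)"
  then obtain u v where "u \<in> Poly_Mapping.keys f" "v \<in> Poly_Mapping.keys g" "w = u + v"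
    using keys_mult[of f g] by auto
  with assms show "set (letters w) \<subseteq> S"
    by (auto simp: carrier_free_algebra plus_free_word_def)
qed

lemma ring_free_algebra: "ring (free_algebra S)"
proof (intro ringI abelian_groupI monoidI)
  fix x assume "x \<in> carrier (free_algebra S)"
  then show "\<exists>y\<in>carrier (free_algebra S). y \<oplus>\<^bsub>free_algebra S\<^esub> x = \<zero>\<^bsub>free_algebra S\<^esub>"
    by (intro bexI[of _ "- x"]) (auto simp: free_algebra_uminus)
qed (auto simp: free_algebra_add free_algebra_mult algebra_simps)

lemma free_scalar_1 [simp]: "free_scalar 1 = 1"
  and free_scalar_0 [simp]: "free_scalar 0 = 0"
  by (simp_all add: free_scalar_def)

lemma free_scalar_add: "free_scalar (x + y) = free_scalar x + free_scalar y"
  and free_scalar_uminus: "free_scalar (- x) = - free_scalar x"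
  and free_scalar_mult: "free_scalar (x * y) = free_scalar x * free_scalar y"
  by (simp_all add: free_scalar_def single_add single_uminus mult_single)

lemma free_scalar_mult_left: "free_scalar x * (free_scalar y * f) = free_scalar (x * y) * f"
  by (simp add: free_scalar_mult mult.assoc)

lemma free_scalar_commute: "f * free_scalar z = free_scalar z * f"
proof -
  have "Poly_Mapping.single w d * free_scalar z = free_scalar z * Poly_Mapping.single w d" for w :: "'a free_word" and d
    by (simp add: free_scalar_def mult_single mult.commute)
  then show ?thesis
    by (subst (1 2) poly_mapping_eq_sum_single[of f])
      (simp add: sum_distrib_left sum_distrib_right)
qed

lemma free_scalar_left_commute: "f * (free_scalar z * g) = free_scalar z * (f * g)"
  by (metis free_scalar_commute mult.assoc)

lemma vector_space_free_algebra: "vector_space (\<lambda>z f. free_scalar z * f)"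
  by unfold_locales (simp_all add: free_scalar_add free_scalar_mult distrib_left distrib_right mult.assoc)

interpretation free: vector_space "\<lambda>z f :: 'x free_word \<Rightarrow>\<^sub>0 complex. free_scalar z * f"
  by (rule vector_space_free_algebra)

lemma subspace_free_algebra: "free.subspace (carrier (free_algebra S))"
  by (auto simp: free.subspace_def free_algebra_add free_algebra_mult)

definition word_functional :: "('x list \<Rightarrow> complex) \<Rightarrow> ('x free_word \<Rightarrow>\<^sub>0 complex) \<Rightarrow> complex" where
  "word_functional \<mu> f = (\<Sum>w\<in>Poly_Mapping.keys f. Poly_Mapping.lookup f w * \<mu> (letters w))"

lemma word_functional_superset:
  assumes "finite T" "Poly_Mapping.keys f \<subseteq> T"
  shows "word_functional \<mu> f = (\<Sum>w\<in>T. Poly_Mapping.lookup f w * \<mu> (letters w))"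
  unfolding word_functional_def
  by (rule sum.mono_neutral_left) (use assms in \<open>auto simp: in_keys_iff\<close>)

lemma word_functional_add:
  "word_functional \<mu> (f + g) = word_functional \<mu> f + word_functional \<mu> g"
proof -
  let ?T = "Poly_Mapping.keys f \<union> Poly_Mapping.keys g"
  have "Poly_Mapping.keys (f + g) \<subseteq> ?T"
    by (rule keys_add)
  then show ?thesis
    by (simp add: word_functional_superset[of ?T] lookup_add distrib_right sum.distrib)
qed

lemma word_functional_0 [simp]: "word_functional \<mu> 0 = 0"
  by (simp add: word_functional_def)

lemma word_functional_sum:
  "word_functional \<mu> (\<Sum>x\<in>T. f x) = (\<Sum>x\<in>T. word_functional \<mu> (f x))"
  by (induction T rule: infinite_finite_induct) (simp_all add: word_functional_add)

lemma word_functional_single: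
  "word_functional \<mu> (Poly_Mapping.single w z) = z * \<mu> (letters w)"
  by (simp add: word_functional_def)

lemma word_functional_sandwich_eq_0:
  assumes x: "x \<in> carrier (free_algebra S)" and y: "y \<in> carrier (free_algebra S)"
    and 0: "\<And>u v. set u \<subseteq> S \<Longrightarrow> set v \<subseteq> S \<Longrightarrow> word_functional \<mu>
        (Poly_Mapping.single (Free_Word u) 1 * f * Poly_Mapping.single (Free_Word v) 1) = 0"
  shows "word_functional \<mu> (x * f * y) = 0"
proof -
  have "x * f * y = (\<Sum>u\<in>Poly_Mapping.keys x. Poly_Mapping.single u (Poly_Mapping.lookup x u) * f)
      * (\<Sum>v\<in>Poly_Mapping.keys y. Poly_Mapping.single v (Poly_Mapping.lookup y v))"
    by (simp flip: poly_mapping_eq_sum_single sum_distrib_right)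
  also have "\<dots> = (\<Sum>u\<in>Poly_Mapping.keys x. \<Sum>v\<in>Poly_Mapping.keys y.
      Poly_Mapping.single u (Poly_Mapping.lookup x u) * f * Poly_Mapping.single v (Poly_Mapping.lookup y v))"
    by (rule sum_product)
  also have "word_functional \<mu> \<dots> = 0"
  proof -
    have "word_functional \<mu> (Poly_Mapping.single u c * f * Poly_Mapping.single v d) = 0"
      if "u \<in> Poly_Mapping.keys x" "v \<in> Poly_Mapping.keys y" for u v c d
    proof -
      have "Poly_Mapping.single u c * f * Poly_Mapping.single v d
          = free_scalar (c * d) * (Poly_Mapping.single u 1 * f * Poly_Mapping.single v 1)"
      proof -
        have "Poly_Mapping.single u c = free_scalar c * Poly_Mapping.single u 1"
          "Poly_Mapping.single v d = free_scalar d * Poly_Mapping.single v 1"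
          by (simp_all add: free_scalar_def mult_single)
        then show ?thesis
          by (simp only: mult.assoc free_scalar_left_commute[of f]
              free_scalar_left_commute[of "Poly_Mapping.single u 1"] free_scalar_mult_left)
      qed
      moreover have "word_functional \<mu> (free_scalar z * g) = z * word_functional \<mu> g" for z and g :: "'a free_word \<Rightarrow>\<^sub>0 complex"
        by (subst (1 2) poly_mapping_eq_sum_single[of g])
          (simp add: sum_distrib_left free_scalar_def mult_single word_functional_sum word_functional_single mult.assoc)
      moreover have "word_functional \<mu> (Poly_Mapping.single u 1 * f * Poly_Mapping.single v 1) = 0"
        using 0[of "letters u" "letters v"] that x y by (auto simp: carrier_free_algebra)
      ultimately show ?thesis by simp
    qed
    then show ?thesis
      by (simp add: word_functional_sum)
  qed
  finally show ?thesis .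
qed

text \<open>A functional that kills every relation between any two words kills the whole two-sided ideal: the
  elements \<open>f\<close> such that it vanishes on all \<open>x * f * y\<close> form an ideal.\<close>

lemma genideal_le_sandwich_kernel:
  assumes R: "R \<subseteq> carrier (free_algebra S)"
    and 0: "\<And>r u v. r \<in> R \<Longrightarrow> set u \<subseteq> S \<Longrightarrow> set v \<subseteq> S \<Longrightarrow> word_functional \<mu>
        (Poly_Mapping.single (Free_Word u) 1 * r * Poly_Mapping.single (Free_Word v) 1) = 0"
    and f: "f \<in> Idl\<^bsub>free_algebra S\<^esub> R"
  shows "word_functional \<mu> f = 0"
proof -
  interpret ring "free_algebra S" by (rule ring_free_algebra)
  let ?C = "carrier (free_algebra S)"
  define K where "K = {f \<in> ?C. \<forall>x\<in>?C. \<forall>y\<in>?C. word_functional \<mu> (x * f * y) = 0}"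
  have "ideal K (free_algebra S)"
  proof (rule idealI[OF ring_free_algebra])
    show "subgroup K (add_monoid (free_algebra S))"
    proof (rule add.subgroupI)
      have "\<zero>\<^bsub>free_algebra S\<^esub> \<in> K" by (simp add: K_def)
      then show "K \<noteq> {}" by blast
    next
      fix a assume a: "a \<in> K"
      have "\<ominus>\<^bsub>free_algebra S\<^esub> a = - a"
        by (rule minus_equality) (use a in \<open>auto simp: K_def free_algebra_uminus\<close>)
      moreover have "word_functional \<mu> (x * - a * y) = 0" if "x \<in> ?C" "y \<in> ?C" for x y
      proof -
        have "word_functional \<mu> (- x * a * y) = 0"
          using a that(2) free_algebra_uminus[OF that(1)] unfolding K_def by blast
        then show ?thesis by simp
      qed
      ultimately show "\<ominus>\<^bsub>free_algebra S\<^esub> a \<in> K"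
        using a by (auto simp: K_def free_algebra_uminus)
    qed (auto simp: K_def free_algebra_add distrib_left distrib_right word_functional_add)
  next
    fix a x assume a: "a \<in> K" and x: "x \<in> ?C"
    have "word_functional \<mu> (y * (x * a) * z) = 0" "word_functional \<mu> (y * (a * x) * z) = 0"
      if "y \<in> ?C" "z \<in> ?C" for y z
      using a that x free_algebra_mult[of y S x] free_algebra_mult[of x S z]
      by (auto simp: K_def mult.assoc)
    then show "x \<otimes>\<^bsub>free_algebra S\<^esub> a \<in> K" "a \<otimes>\<^bsub>free_algebra S\<^esub> x \<in> K"
      using a x by (auto simp: K_def free_algebra_mult)
  qed
  moreover have "R \<subseteq> K"
    using R word_functional_sandwich_eq_0[OF _ _ 0] by (auto simp: K_def)
  ultimately have "f \<in> K"
    using genideal_minimal f by blast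
  then have "word_functional \<mu> (1 * f * 1) = 0"
    using free_algebra_1[of S] unfolding K_def by blast
  then show ?thesis
    by simp
qed

section \<open>The defining relations\<close>

locale quantum_matrix =
  fixes n :: nat and p q :: "nat \<Rightarrow> nat \<Rightarrow> complex" and lam :: complex
  assumes pq: "p_lambda_condition n p q lam"
begin

definition S :: "nat set" where "S = {1..n}"
definition W :: "((nat \<times> nat) free_word \<Rightarrow>\<^sub>0 complex) set" where "W = carrier (qmat_free n)"
abbreviation N :: "((nat \<times> nat) free_word \<Rightarrow>\<^sub>0 complex) set" where "N \<equiv> qmat_ideal n p q"
abbreviation a :: "nat \<Rightarrow> nat \<Rightarrow> (nat \<times> nat) free_word \<Rightarrow>\<^sub>0 complex" where "a i j \<equiv> free_gen (i, j)"
abbreviation C :: "complex \<Rightarrow> (nat \<times> nat) free_word \<Rightarrow>\<^sub>0 complex" where "C \<equiv> free_scalar"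

lemma finite_S [simp]: "finite S"
  by (simp add: S_def)

lemma subspace_W: "free.subspace W"
  unfolding W_def by (rule subspace_free_algebra)

lemma a_W: "i \<in> S \<Longrightarrow> j \<in> S \<Longrightarrow> a i j \<in> W"
  unfolding W_def S_def by (rule free_algebra_gen) blast

lemma C_W [simp]: "C z \<in> W" and one_W [simp]: "1 \<in> W"
  by (simp_all add: W_def)

lemma mult_W: "x \<in> W \<Longrightarrow> y \<in> W \<Longrightarrow> x * y \<in> W"
  unfolding W_def by (rule free_algebra_mult)

lemmas W_closed = mult_W a_W C_W one_W free.subspace_sum[OF subspace_W] free.subspace_add[OF subspace_W]
  free.subspace_diff[OF subspace_W]

lemma relations_W: "qmat_relations n p q \<subseteq> W"
  unfolding qmat_relations_def Let_def S_def[symmetric]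
  by (auto intro!: W_closed)

sublocale W: ring "qmat_free n" by (rule ring_free_algebra)

sublocale N: ideal N "qmat_free n"
  unfolding qmat_ideal_def by (rule W.genideal_ideal[OF relations_W[unfolded W_def]])

lemma relations_N: "r \<in> qmat_relations n p q \<Longrightarrow> r \<in> N"
  using W.genideal_self[OF relations_W[unfolded W_def]] by (auto simp: qmat_ideal_def)

lemma N_mult_left: "w \<in> W \<Longrightarrow> x \<in> N \<Longrightarrow> w * x \<in> N"
  and N_mult_right: "w \<in> W \<Longrightarrow> x \<in> N \<Longrightarrow> x * w \<in> N"
  using N.I_l_closed[of x w] N.I_r_closed[of x w] by (simp_all add: W_def)

lemma subspace_N: "free.subspace N"
  using N.zero_closed N.a_closed by (auto simp: free.subspace_def intro: N_mult_left)

lemma p_nz: "i \<in> S \<Longrightarrow> j \<in> S \<Longrightarrow> p i j \<noteq> 0"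
  and q_nz: "i \<in> S \<Longrightarrow> j \<in> S \<Longrightarrow> q i j \<noteq> 0"
  using pq unfolding p_lambda_condition_def S_def[symmetric] by (metis mult_zero_left zero_neq_one)+

lemma pq_lam: "i \<in> S \<Longrightarrow> j \<in> S \<Longrightarrow> i < j \<Longrightarrow> p i j * q i j = lam"
  using pq unfolding p_lambda_condition_def S_def[symmetric] by blast

text \<open>The structure constants \<open>\<xi>\<^sub>j \<xi>\<^sub>k = row_twist j k \<xi>\<^sub>{\<^sub>j\<^sub>,\<^sub>k\<^sub>}\<close>, normalised on increasing pairs.\<close>

definition row_twist :: "nat \<Rightarrow> nat \<Rightarrow> complex" where
  "row_twist j k = (if j > k then - q k j else 1)"

text \<open>The structure constants of \<open>\<eta>\<^sub>k \<eta>\<^sub>i = col_twist i k \<eta>\<^sub>{\<^sub>i\<^sub>,\<^sub>k\<^sub>}\<close>, with the factors in reversed order, since column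
  minors are built by multiplication from the right. Accordingly they are normalised on decreasing
  pairs, and column lists are taken in decreasing order.\<close>

definition col_twist :: "nat \<Rightarrow> nat \<Rightarrow> complex" where
  "col_twist i k = (if i < k then - p i k else 1)"

lemma twist_nz: "i \<in> S \<Longrightarrow> j \<in> S \<Longrightarrow> row_twist i j \<noteq> 0" "i \<in> S \<Longrightarrow> j \<in> S \<Longrightarrow> col_twist i j \<noteq> 0"
  using p_nz q_nz by (auto simp: row_twist_def col_twist_def)

lemma same_row_relation:
  "i \<in> S \<Longrightarrow> k \<in> S \<Longrightarrow> l \<in> S \<Longrightarrow> k < l \<Longrightarrow> a i k * a i l - C (q k l) * a i l * a i k \<in> N"
  by (rule relations_N) (unfold qmat_relations_def Let_def S_def[symmetric], blast)

lemma same_col_relation: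
  "i \<in> S \<Longrightarrow> j \<in> S \<Longrightarrow> k \<in> S \<Longrightarrow> i < j \<Longrightarrow> a i k * a j k - C (p i j) * a j k * a i k \<in> N"
  by (rule relations_N) (unfold qmat_relations_def Let_def S_def[symmetric], blast)

lemma q_minor_relation:
  "i \<in> S \<Longrightarrow> j \<in> S \<Longrightarrow> k \<in> S \<Longrightarrow> l \<in> S \<Longrightarrow> i < j \<Longrightarrow> k < l \<Longrightarrow>
    (a i k * a j l - C (q k l / q i j) * a j l * a i k)
          - (C (q k l) * a i l * a j k - C (1 / q i j) * a j k * a i l) \<in> N"
  by (rule relations_N) (unfold qmat_relations_def Let_def S_def[symmetric], blast)

lemma p_minor_relation:
  "i \<in> S \<Longrightarrow> j \<in> S \<Longrightarrow> k \<in> S \<Longrightarrow> l \<in> S \<Longrightarrow> i < j \<Longrightarrow> k < l \<Longrightarrow>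
    (a i k * a j l - C (p i j / p k l) * a j l * a i k)
          - (C (p i j) * a j k * a i l - C (1 / p k l) * a i l * a j k) \<in> N"
  by (rule relations_N) (unfold qmat_relations_def Let_def S_def[symmetric], blast)

lemma C_left: "f * C z = C z * f" "f * (C z * g) = C z * (f * g)"
  by (rule free_scalar_commute free_scalar_left_commute)+

sublocale row: exterior_coaction "\<lambda>z f. C z * f" "\<lambda>i j f. a i j * f" W N row_twist S
proof (intro exterior_coaction.intro exterior_coaction_axioms.intro)
  show "vector_space (\<lambda>z f. C z * f)" by (rule vector_space_free_algebra)
next
  fix i j k v assume 1: "i \<in> S" "j \<in> S" "k \<in> S" "j < k" "v \<in> W"
  have "C (row_twist j k) * (a i j * (a i k * v)) + C (row_twist k j) * (a i k * (a i j * v))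
    = (a i j * a i k - C (q j k) * a i k * a i j) * v"
    using \<open>j < k\<close> by (simp add: row_twist_def free_scalar_uminus algebra_simps)
  then show "C (row_twist j k) * (a i j * (a i k * v)) + C (row_twist k j) * (a i k * (a i j * v)) \<in> N"
    using N_mult_right[OF 1(5) same_row_relation[OF 1(1-4)]] by simp
next
  fix i i' j k v assume 1: "i \<in> S" "i' \<in> S" "i < i'" "j \<in> S" "k \<in> S" "j < k" "v \<in> W"
  let ?r = "(a i j * a i' k - C (q j k / q i i') * a i' k * a i j)
          - (C (q j k) * a i k * a i' j - C (1 / q i i') * a i' j * a i k)"
  have C0: "C (- q i i') * C (q j k / q i i') = C (- q j k)"
    "C (- q i i') * C (1 / q i i') = - 1"
    using q_nz[OF 1(1,2)] by (simp_all flip: free_scalar_mult) (simp add: free_scalar_uminus)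
  have C1: "C (- q i i') * (C (q j k / q i i') * f) = C (- q j k) * f"
    "C (- q i i') * (C (1 / q i i') * f) = - f" for f
    by (simp_all only: C0 flip: mult.assoc) simp
  have "C (row_twist i' i) * (C (row_twist j k) * (a i j * (a i' k * v)) + C (row_twist k j) * (a i k * (a i' j * v)))
      - C (row_twist i i') * (C (row_twist j k) * (a i' j * (a i k * v)) + C (row_twist k j) * (a i' k * (a i j * v)))
    = C (- q i i') * ?r * v"
    using 1(3,6) by (simp add: left_diff_distrib right_diff_distrib distrib_left mult.assoc C1 row_twist_def q_nz[OF 1(1,2)])
  moreover have "C (- q i i') * ?r * v \<in> N"
    using q_minor_relation[OF 1(1,2,4,5,3,6)] 1 by (intro N_mult_right N_mult_left) auto
  ultimately show "C (row_twist i' i) * (C (row_twist j k) * (a i j * (a i' k * v)) + C (row_twist k j) * (a i k * (a i' j * v)))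
      - C (row_twist i i') * (C (row_twist j k) * (a i' j * (a i k * v)) + C (row_twist k j) * (a i' k * (a i j * v))) \<in> N"
    by simp
qed (auto simp: distrib_left C_left subspace_N subspace_W twist_nz intro: W_closed N_mult_left)

sublocale col: exterior_coaction "\<lambda>z f. C z * f" "\<lambda>j i f. f * a i j" W N col_twist S
proof (intro exterior_coaction.intro exterior_coaction_axioms.intro)
  show "vector_space (\<lambda>z f. C z * f)" by (rule vector_space_free_algebra)
next
  fix j i k v assume 1: "j \<in> S" "i \<in> S" "k \<in> S" "i < k" "v \<in> W"
  have "C (col_twist i k) * (v * a k j * a i j) + C (col_twist k i) * (v * a i j * a k j)
    = v * (a i j * a k j - C (p i k) * a k j * a i j)"
    using \<open>i < k\<close> by (simp add: col_twist_def free_scalar_uminus algebra_simps C_left(2)[of v])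
  then show "C (col_twist i k) * (v * a k j * a i j) + C (col_twist k i) * (v * a i j * a k j) \<in> N"
    using N_mult_left[OF 1(5) same_col_relation[OF 1(2,3,1,4)]] by simp
next
  fix j j' i k v assume 1: "j \<in> S" "j' \<in> S" "j < j'" "i \<in> S" "k \<in> S" "i < k" "v \<in> W"
  let ?r = "(a i j * a k j' - C (p i k / p j j') * a k j' * a i j)
          - (C (p i k) * a k j * a i j' - C (1 / p j j') * a i j' * a k j)"
  have C0: "C (p j j') * C (p i k / p j j') = C (p i k)"
    "C (p j j') * C (1 / p j j') = 1"
    using p_nz[OF 1(1,2)] by (simp_all flip: free_scalar_mult)
  have C1: "C (p j j') * (C (p i k / p j j') * f) = C (p i k) * f"
    "C (p j j') * (C (1 / p j j') * f) = f" for f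
    by (simp_all only: C0 flip: mult.assoc) simp
  have "C (col_twist j' j) * (C (col_twist i k) * (v * a k j' * a i j) + C (col_twist k i) * (v * a i j' * a k j))
      - C (col_twist j j') * (C (col_twist i k) * (v * a k j * a i j') + C (col_twist k i) * (v * a i j * a k j'))
    = C (p j j') * (v * ?r)"
    using 1(3,6) by (simp add: left_diff_distrib right_diff_distrib distrib_left mult.assoc C1 C_left(2)[of v] col_twist_def p_nz[OF 1(1,2)])
  moreover have "C (p j j') * (v * ?r) \<in> N"
    using p_minor_relation[OF 1(4,5,1,2,6,3)] 1 by (intro N_mult_left) auto
  ultimately show "C (col_twist j' j) * (C (col_twist i k) * (v * a k j' * a i j) + C (col_twist k i) * (v * a i j' * a k j))
      - C (col_twist j j') * (C (col_twist i k) * (v * a k j * a i j') + C (col_twist k i) * (v * a i j * a k j')) \<in> N"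
    by simp
qed (auto simp: distrib_right mult.assoc subspace_N subspace_W twist_nz intro: W_closed N_mult_right)

text \<open>The two long relations have the same left-hand side because \<open>q\<^sub>k\<^sub>l / q\<^sub>i\<^sub>j = p\<^sub>i\<^sub>j / p\<^sub>k\<^sub>l\<close>, both being
  \<open>\<lambda> / (p\<^sub>k\<^sub>l q\<^sub>i\<^sub>j)\<close>. Their difference relates \<open>a\<^sub>i\<^sub>l a\<^sub>j\<^sub>k\<close> and \<open>a\<^sub>j\<^sub>k a\<^sub>i\<^sub>l\<close> with the common factor \<open>\<lambda> + 1\<close>,
  and this is the place where \<open>\<lambda> \<noteq> -1\<close> enters.\<close>

lemma cross_relation:
  assumes "i \<in> S" "j \<in> S" "k \<in> S" "l \<in> S" "i < j" "k < l"
  shows "a i l * a j k - C (p k l / q i j) * a j k * a i l \<in> N"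
proof -
  \<comment> \<open>The factor that normalises the coefficient of the first product to 1.\<close>
  let ?u = "- (p k l / (lam + 1))"
  let ?rq = "(a i k * a j l - C (q k l / q i j) * a j l * a i k)
          - (C (q k l) * a i l * a j k - C (1 / q i j) * a j k * a i l)"
  let ?rp = "(a i k * a j l - C (p i j / p k l) * a j l * a i k)
          - (C (p i j) * a j k * a i l - C (1 / p k l) * a i l * a j k)"
  have scale: "C u * (- (C x * f) + C y * g) = C (- u * x) * f + C (u * y) * g" for u x y f g
    by (simp add: right_diff_distrib distrib_left free_scalar_mult_left free_scalar_uminus)
  have nz: "p i j \<noteq> 0" "q i j \<noteq> 0" "p k l \<noteq> 0" "q k l \<noteq> 0" "lam + 1 \<noteq> 0"
    using p_nz q_nz assms pq by (auto simp: p_lambda_condition_def eq_neg_iff_add_eq_0)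
  have lam: "p i j * q i j = lam" "p k l * q k l = lam"
    using pq_lam assms by auto
  have eq: "q k l / q i j = p i j / p k l"
    using nz lam by (simp add: field_simps)
  have "?rq - ?rp = - (C (q k l + 1 / p k l) * (a i l * a j k)) + C (1 / q i j + p i j) * (a j k * a i l)"
    unfolding eq by (simp add: free_scalar_add algebra_simps)
  then have "C ?u * (?rq - ?rp) = C (- ?u * (q k l + 1 / p k l)) * (a i l * a j k)
      + C (?u * (1 / q i j + p i j)) * (a j k * a i l)"
    by (simp only: scale)
  also have "- ?u * (q k l + 1 / p k l) = 1"
  proof -
    have "p k l * (q k l + 1 / p k l) = lam + 1"
      using nz lam by (simp add: distrib_left)
    then show ?thesis
      using nz by simp
  qed
  also have "?u * (1 / q i j + p i j) = - (p k l / q i j)"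
  proof -
    have "1 / q i j + p i j = (lam + 1) / q i j"
      using nz lam by (simp add: field_simps)
    then show ?thesis
      using nz by simp
  qed
  also have "C 1 * (a i l * a j k) + C (- (p k l / q i j)) * (a j k * a i l)
      = a i l * a j k - C (p k l / q i j) * a j k * a i l"
    by (simp add: free_scalar_uminus mult.assoc)
  finally show ?thesis
    using N_mult_left[of "C ?u" "?rq - ?rp"] free.subspace_diff[OF subspace_N q_minor_relation[OF assms] p_minor_relation[OF assms]]
    by simp
qed

section \<open>Laplace expansions, row minors and column minors\<close>

definition cong :: "((nat \<times> nat) free_word \<Rightarrow>\<^sub>0 complex) \<Rightarrow> ((nat \<times> nat) free_word \<Rightarrow>\<^sub>0 complex) \<Rightarrow> bool"
    (infix "\<approx>" 50) where
  "x \<approx> y \<longleftrightarrow> x - y \<in> N"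

lemma cong_refl [simp]: "x \<approx> x"
  by (simp add: cong_def free.subspace_0[OF subspace_N])

lemma cong_sym: "x \<approx> y \<Longrightarrow> y \<approx> x"
  using free.subspace_neg[OF subspace_N, of "x - y"] by (simp add: cong_def)

lemma cong_trans [trans]: "x \<approx> y \<Longrightarrow> y \<approx> z \<Longrightarrow> x \<approx> z"
  using free.subspace_add[OF subspace_N, of "x - y" "y - z"] by (simp add: cong_def)

lemma cong_add: "x \<approx> y \<Longrightarrow> x' \<approx> y' \<Longrightarrow> x + x' \<approx> y + y'"
  using free.subspace_add[OF subspace_N, of "x - y" "x' - y'"] by (simp add: cong_def algebra_simps)

lemma cong_sum: "(\<And>t. t \<in> T \<Longrightarrow> f t \<approx> g t) \<Longrightarrow> (\<Sum>t\<in>T. f t) \<approx> (\<Sum>t\<in>T. g t)"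
  unfolding cong_def sum_subtractf[symmetric] by (rule free.subspace_sum[OF subspace_N])

lemma cong_mult_left: "w \<in> W \<Longrightarrow> x \<approx> y \<Longrightarrow> w * x \<approx> w * y"
  unfolding cong_def right_diff_distrib[symmetric] by (rule N_mult_left)

lemma cong_mult_right: "w \<in> W \<Longrightarrow> x \<approx> y \<Longrightarrow> x * w \<approx> y * w"
  unfolding cong_def left_diff_distrib[symmetric] by (rule N_mult_right)

lemmas cong_scalar = cong_mult_left[OF C_W]

definition row_minor :: "nat set \<Rightarrow> nat set \<Rightarrow> (nat \<times> nat) free_word \<Rightarrow>\<^sub>0 complex" where
  "row_minor I J = row.minor (sorted_list_of_set I) 1 J"

definition col_minor :: "nat set \<Rightarrow> nat set \<Rightarrow> (nat \<times> nat) free_word \<Rightarrow>\<^sub>0 complex" where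
  "col_minor I J = col.minor (rev (sorted_list_of_set J)) 1 I"

lemma finite_subset_S: "I \<subseteq> S \<Longrightarrow> finite I"
  using finite_subset[OF _ finite_S] by auto

lemma row_minor_W: "I \<subseteq> S \<Longrightarrow> J \<subseteq> S \<Longrightarrow> row_minor I J \<in> W"
  unfolding row_minor_def by (rule row.minor_W) (auto simp: finite_subset_S)

text \<open>Increasing lists of rows are those along which \<open>row_twist\<close> is normalised.\<close>

lemma row_expansion:
  assumes "I \<subseteq> S" "J \<subseteq> S" "i \<in> I" "i' \<in> I"
  shows "(\<Sum>j\<in>J. C (index_weight row_twist j (J - {j})) * (a i' j * row_minor (I - {i}) (J - {j})))
    \<approx> (if i' = i then C (index_weight row_twist i (I - {i})) * row_minor I J else 0)"
proof (cases "i' = i")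
  case True
  have "sorted_wrt (\<lambda>i k. row_twist i k = 1) (sorted_list_of_set I)"
    by (rule sorted_wrt_mono_rel[of _ "(<)"]) (auto simp: row_twist_def)
  from row.X_minor_sorted[OF this _ _ _ assms(2) one_W, of i]
  show ?thesis
    using True assms finite_subset_S[of I]
    by (simp add: cong_def row.X_def row_minor_def sorted_list_of_set_remove)
next
  case False
  have "row.X i' (row.minor (sorted_list_of_set (I - {i})) 1) J \<in> N"
    by (rule row.X_minor_repeated) (use False assms finite_subset_S[of I] in auto)
  with False show ?thesis
    by (simp add: cong_def row.X_def row_minor_def)
qed

lemma col_expansion:
  assumes "I \<subseteq> S" "J \<subseteq> S" "j \<in> J" "j' \<in> J"
  shows "(\<Sum>i\<in>I. C (index_weight col_twist i (I - {i})) * (col_minor (I - {i}) (J - {j}) * a i j'))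
    \<approx> (if j' = j then C (index_weight col_twist j (J - {j})) * col_minor I J else 0)"
proof (cases "j' = j")
  case True
  have "sorted_wrt (\<lambda>i k. col_twist k i = 1) (sorted_list_of_set J)"
    by (rule sorted_wrt_mono_rel[of _ "(<)"]) (auto simp: col_twist_def)
  then have "sorted_wrt (\<lambda>i k. col_twist i k = 1) (rev (sorted_list_of_set J))"
    by (simp add: sorted_wrt_rev)
  from col.X_minor_sorted[OF this _ _ _ assms(1) one_W, of j]
  have "col.X j (col.minor (remove1 j (rev (sorted_list_of_set J))) 1) I -
     C (index_weight col_twist j (J - {j})) * col.minor (rev (sorted_list_of_set J)) 1 I \<in> N"
    using assms finite_subset_S[of J] by simp
  moreover have "remove1 j (rev (sorted_list_of_set J)) = rev (sorted_list_of_set (J - {j}))"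
    using finite_subset_S[OF assms(2)]
    by (simp add: sorted_list_of_set_remove distinct_remove1_removeAll removeAll_filter_not_eq rev_filter)
  ultimately show ?thesis
    using True by (simp add: cong_def col.X_def col_minor_def)
next
  case False
  have "col.X j' (col.minor (rev (sorted_list_of_set (J - {j}))) 1) I \<in> N"
    by (rule col.X_minor_repeated) (use False assms finite_subset_S[of J] in auto)
  with False show ?thesis
    by (simp add: cong_def col.X_def col_minor_def)
qed

text \<open>Commutation up to scalars is multiplicative, so the scalar for a minor is collected factor by
  factor; as it depends only on the rows and columns that occur, all summands share it.\<close>

lemma row_list_minor_twisted_commute:
  assumes g: "g \<in> W" and "set is \<subseteq> S" "J \<subseteq> S"
    and rel: "\<And>i j. i \<in> set is \<Longrightarrow> j \<in> J \<Longrightarrow> g * a i j \<approx> C (\<alpha> i * \<beta> j) * (a i j * g)"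
  shows "g * row.minor is 1 J \<approx> C (prod_list (map \<alpha> is) * prod \<beta> J) * (row.minor is 1 J * g)"
  using assms(2-4)
proof (induction "is" arbitrary: J)
  case (Cons i "is")
  let ?m = "\<lambda>j. row.minor is 1 (J - {j})"
  let ?s = "\<lambda>j. index_weight row_twist j (J - {j})"
  let ?w = "prod_list (map \<alpha> (i # is)) * prod \<beta> J"
  have "g * (C (?s j) * (a i j * ?m j)) \<approx> C ?w * (C (?s j) * (a i j * ?m j) * g)" if "j \<in> J" for j
  proof -
    let ?w' = "prod_list (map \<alpha> is) * prod \<beta> (J - {j})"
    have ij: "i \<in> S" "j \<in> S" and mW: "?m j \<in> W"
      using Cons.prems that row.minor_W[of "is" "J - {j}" 1] by auto
    have w: "?w = \<alpha> i * \<beta> j * ?w'"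
      using that finite_subset_S[OF Cons.prems(2)] by (simp add: prod.remove mult_ac)
    have "g * (C (?s j) * (a i j * ?m j)) = C (?s j) * (g * a i j * ?m j)"
      by (simp add: C_left(2)[of g] mult.assoc)
    also have "\<dots> \<approx> C (?s j) * (C (\<alpha> i * \<beta> j) * (a i j * g) * ?m j)"
      using Cons.prems that mW by (intro cong_scalar cong_mult_right) auto
    also have "\<dots> = C (?s j) * (C (\<alpha> i * \<beta> j) * (a i j * (g * ?m j)))"
      by (simp add: mult.assoc)
    also have "\<dots> \<approx> C (?s j) * (C (\<alpha> i * \<beta> j) * (a i j * (C ?w' * (?m j * g))))"
      using Cons ij that by (intro cong_scalar cong_mult_left a_W Cons.IH) auto
    also have "\<dots> = C ?w * (C (?s j) * (a i j * ?m j) * g)"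
      unfolding w by (simp add: C_left(2)[of "a i j"] mult.assoc free_scalar_mult_left)
    finally show ?thesis .
  qed
  then show ?case
    unfolding row.minor_Cons row.X_def sum_distrib_left sum_distrib_right
    by (intro cong_sum) auto
qed (auto simp: row.minor_Nil)

lemma row_minor_twisted_commute:
  assumes "g \<in> W" "I \<subseteq> S" "J \<subseteq> S"
    and "\<And>i j. i \<in> I \<Longrightarrow> j \<in> J \<Longrightarrow> g * a i j \<approx> C (\<alpha> i * \<beta> j) * (a i j * g)"
  shows "g * row_minor I J \<approx> C (prod \<alpha> I * prod \<beta> J) * (row_minor I J * g)"
proof -
  have "prod_list (map \<alpha> (sorted_list_of_set I)) = prod \<alpha> I"
    using prod.distinct_set_conv_list[of "sorted_list_of_set I" \<alpha>] finite_subset_S[OF assms(2)] by simp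
  then show ?thesis
    using row_list_minor_twisted_commute[of g "sorted_list_of_set I" J \<alpha> \<beta>] assms
      finite_subset_S[OF assms(2)]
    by (simp add: row_minor_def)
qed

text \<open>The summand in which the two expansions below meet: the top right entry \<open>a\<^sub>i\<^sub>l\<close> stands on the left of
  its complementary minor in the row expansion and on the right in the column expansion. Passing it
  through contributes \<open>p\<^sub>k\<^sub>l\<close> for each column and \<open>1 / q\<^sub>i\<^sub>j\<close> for each row, and since there are as many
  rows as columns, \<open>p q = \<lambda>\<close> turns one weight into the other.\<close>

lemma corner_past_minor:
  assumes "I \<subseteq> S" "J \<subseteq> S" "i \<in> S" "l \<in> S" "\<And>j. j \<in> I \<Longrightarrow> i < j" "\<And>k. k \<in> J \<Longrightarrow> k < l" "card I = card J"
  shows "C (index_weight row_twist l J) * (a i l * row_minor I J)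
    \<approx> C (index_weight col_twist i I) * (row_minor I J * a i l)"
proof -
  have "a i l * row_minor I J \<approx> C ((\<Prod>j\<in>I. 1 / q i j) * (\<Prod>k\<in>J. p k l)) * (row_minor I J * a i l)"
  proof (rule row_minor_twisted_commute)
    fix j k assume jk: "j \<in> I" "k \<in> J"
    then have "a i l * a j k - C (p k l / q i j) * a j k * a i l \<in> N"
      using assms by (intro cross_relation) auto
    then show "a i l * a j k \<approx> C (1 / q i j * p k l) * (a j k * a i l)"
      by (simp add: cong_def mult.assoc)
  qed (use assms a_W in auto)
  then have "C (index_weight row_twist l J) * (a i l * row_minor I J) \<approx> C (index_weight row_twist l J) *
      (C ((\<Prod>j\<in>I. 1 / q i j) * (\<Prod>k\<in>J. p k l)) * (row_minor I J * a i l))"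
    by (rule cong_scalar)
  also have "\<dots> = C (index_weight row_twist l J * ((\<Prod>j\<in>I. 1 / q i j) * (\<Prod>k\<in>J. p k l))) * (row_minor I J * a i l)"
    by (simp add: free_scalar_mult_left)
  also have "index_weight row_twist l J * ((\<Prod>j\<in>I. 1 / q i j) * (\<Prod>k\<in>J. p k l)) = index_weight col_twist i I"
  proof -
    have "index_weight row_twist l J * (\<Prod>k\<in>J. p k l) = (\<Prod>k\<in>J. - lam)"
      unfolding index_weight_def prod.distrib[symmetric]
    proof (rule prod.cong[OF refl])
      fix k assume "k \<in> J"
      then show "row_twist l k * p k l = - lam"
        using assms pq_lam[of k l] by (auto simp: row_twist_def mult.commute)
    qed
    also have "\<dots> = (\<Prod>j\<in>I. - lam)"
      using assms by simp
    finally have "index_weight row_twist l J * ((\<Prod>j\<in>I. 1 / q i j) * (\<Prod>k\<in>J. p k l))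
       = (\<Prod>j\<in>I. - lam * (1 / q i j))"
      by (subst prod.distrib) (simp add: mult_ac)
    also have "\<dots> = index_weight col_twist i I"
      unfolding index_weight_def
    proof (rule prod.cong[OF refl])
      fix j assume "j \<in> I"
      then show "- lam * (1 / q i j) = col_twist i j"
        using assms pq_lam[of i j] q_nz[of i j] by (auto simp: col_twist_def field_simps)
    qed
    finally show ?thesis .
  qed
  finally show ?thesis .
qed

text \<open>Induction on the size. The row minor is expanded along its first row and then, being a column minor
  by induction, along the last column; the column minor is expanded in the opposite order. The double
  sums over the minors with two rows and two columns removed agree term by term, as removing the
  first row does not change the weight of the later rows and removing the last column does not change
  the weight of the earlier columns. What remains is the corner term.\<close>

lemma row_minor_cong_col_minor:
  assumes "I \<subseteq> S" "J \<subseteq> S" "card I = card J"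
  shows "row_minor I J \<approx> col_minor I J"
  using assms
proof (induction "card I" arbitrary: I J rule: less_induct)
  case less
  have fin: "finite I" "finite J"
    using less.prems finite_subset_S by auto
  show ?case
  proof (cases "I = {}")
    case True
    then show ?thesis
      using less.prems fin by (simp add: row_minor_def col_minor_def row.minor_Nil col.minor_Nil)
  next
    case False
    then have "J \<noteq> {}"
      using less.prems fin by auto
    define i where "i = Min I"
    define l where "l = Max J"
    have iI: "i \<in> I" "\<And>j. j \<in> I - {i} \<Longrightarrow> i < j" and lJ: "l \<in> J" "\<And>k. k \<in> J - {l} \<Longrightarrow> k < l"
      using fin False \<open>J \<noteq> {}\<close> by (auto simp: i_def l_def less_le)
    have sub: "I - T \<subseteq> S" "J - T \<subseteq> S" for T
      using less.prems by auto
    have iS: "i \<in> S" "l \<in> S"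
      using iI(1) lJ(1) less.prems by auto
    let ?s = "\<lambda>j K. index_weight row_twist j K" and ?t = "\<lambda>j K. index_weight col_twist j K"
    let ?m = "\<lambda>j k. row_minor (I - {i} - {j}) (J - {l} - {k})"
    have IH: "row_minor (I - {j}) (J - {k}) \<approx> col_minor (I - {j}) (J - {k})" if "j \<in> I" "k \<in> J" for j k
    proof (rule less.hyps)
      show "card (I - {j}) < card I"
        using that fin by (intro card_Diff1_less)
      show "I - {j} \<subseteq> S" "J - {k} \<subseteq> S"
        by (rule sub)+
      show "card (I - {j}) = card (J - {k})"
        using less.prems that fin by simp
    qed
    have IH2: "row_minor (I - {i} - {j}) (J - {l} - {k}) \<approx> col_minor (I - {i} - {j}) (J - {l} - {k})"
      if "j \<in> I - {i}" "k \<in> J - {l}" for j k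
    proof (rule less.hyps)
      show "card (I - {i} - {j}) < card I"
        using fin iI(1) by (intro psubset_card_mono) auto
      show "I - {i} - {j} \<subseteq> S" "J - {l} - {k} \<subseteq> S"
        using less.prems by auto
      show "card (I - {i} - {j}) = card (J - {l} - {k})"
        using less.prems that fin iI(1) lJ(1) by simp
    qed
    \<comment> \<open>Nothing precedes the first row and nothing follows the last column, so removing them has weight 1.\<close>
    have wrow: "?s i (K - {i}) = 1" if "K \<subseteq> I" for K
      unfolding index_weight_def by (rule prod.neutral) (use iI that in \<open>force simp: row_twist_def\<close>)
    have wcol: "?t l (K - {l}) = 1" if "K \<subseteq> J" for K
      unfolding index_weight_def by (rule prod.neutral) (use lJ that in \<open>force simp: col_twist_def\<close>)
    have row: "row_minor K L \<approx> (\<Sum>k\<in>L. C (?s k (L - {k})) * (a i k * row_minor (K - {i}) (L - {k})))"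
      if "K \<subseteq> I" "L \<subseteq> J" "i \<in> K" for K L
      using cong_sym[OF row_expansion[of K L i i]] wrow[OF that(1)] that less.prems by auto
    have col: "col_minor K L \<approx> (\<Sum>j\<in>K. C (?t j (K - {j})) * (col_minor (K - {j}) (L - {l}) * a j l))"
      if "K \<subseteq> I" "L \<subseteq> J" "l \<in> L" for K L
      using cong_sym[OF col_expansion[of K L l l]] wcol[OF that(2)] that less.prems by auto
    \<comment> \<open>The part of either expansion that avoids the corner.\<close>
    define D where "D = (\<Sum>k\<in>J - {l}. \<Sum>j\<in>I - {i}.
      C (?s k (J - {l} - {k}) * ?t j (I - {i} - {j})) * (a i k * ?m j k * a j l))"
    have "row_minor I J \<approx> (\<Sum>k\<in>J. C (?s k (J - {k})) * (a i k * row_minor (I - {i}) (J - {k})))"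
      by (rule row) (use iI in auto)
    also have "\<dots> = C (?s l (J - {l})) * (a i l * row_minor (I - {i}) (J - {l})) +
       (\<Sum>k\<in>J - {l}. C (?s k (J - {k})) * (a i k * row_minor (I - {i}) (J - {k})))"
      using fin lJ by (intro sum.remove)
    also have "\<dots> \<approx> C (?t i (I - {i})) * (row_minor (I - {i}) (J - {l}) * a i l) + D"
    proof (rule cong_add)
      show "C (?s l (J - {l})) * (a i l * row_minor (I - {i}) (J - {l})) \<approx>
         C (?t i (I - {i})) * (row_minor (I - {i}) (J - {l}) * a i l)"
        by (rule corner_past_minor) (use sub iS iI lJ less.prems fin in auto)
      show "(\<Sum>k\<in>J - {l}. C (?s k (J - {k})) * (a i k * row_minor (I - {i}) (J - {k}))) \<approx> D"
        unfolding D_def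
      proof (rule cong_sum)
        fix k assume k: "k \<in> J - {l}"
        have kS: "k \<in> S" using k less.prems by auto
        have K: "J - {k} - {l} = J - {l} - {k}" by auto
        have "?s k (J - {k}) = row_twist k l * ?s k (J - {k} - {l})"
          using fin k lJ by (intro index_weight_remove) auto
        then have s: "?s k (J - {k}) = ?s k (J - {l} - {k})"
          using lJ(2)[OF k] by (simp add: row_twist_def K)
        have "row_minor (I - {i}) (J - {k}) \<approx> col_minor (I - {i}) (J - {k})"
          using k iI by (intro IH) auto
        also have "\<dots> \<approx> (\<Sum>j\<in>I - {i}. C (?t j (I - {i} - {j})) * (col_minor (I - {i} - {j}) (J - {k} - {l}) * a j l))"
          by (rule col) (use k lJ in auto)
        also have "\<dots> \<approx> (\<Sum>j\<in>I - {i}. C (?t j (I - {i} - {j})) * (?m j k * a j l))"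
          unfolding K
          by (intro cong_sum cong_scalar cong_mult_right a_W cong_sym[OF IH2]) (use k less.prems iS in auto)
        finally have "C (?s k (J - {k})) * (a i k * row_minor (I - {i}) (J - {k})) \<approx>
          C (?s k (J - {k})) * (a i k * (\<Sum>j\<in>I - {i}. C (?t j (I - {i} - {j})) * (?m j k * a j l)))"
          using iS kS by (intro cong_scalar cong_mult_left a_W)
        also have "\<dots> = (\<Sum>j\<in>I - {i}.
          C (?s k (J - {l} - {k}) * ?t j (I - {i} - {j})) * (a i k * ?m j k * a j l))"
          unfolding s sum_distrib_left
          by (simp add: C_left(2)[of "a i k"] free_scalar_mult_left mult.assoc)
        finally show "C (?s k (J - {k})) * (a i k * row_minor (I - {i}) (J - {k})) \<approx> (\<Sum>j\<in>I - {i}.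
          C (?s k (J - {l} - {k}) * ?t j (I - {i} - {j})) * (a i k * ?m j k * a j l))" .
      qed
    qed
    also have "\<dots> \<approx> C (?t i (I - {i})) * (col_minor (I - {i}) (J - {l}) * a i l) +
       (\<Sum>j\<in>I - {i}. C (?t j (I - {j})) * (col_minor (I - {j}) (J - {l}) * a j l))"
    proof (rule cong_add)
      show "C (?t i (I - {i})) * (row_minor (I - {i}) (J - {l}) * a i l) \<approx>
         C (?t i (I - {i})) * (col_minor (I - {i}) (J - {l}) * a i l)"
        by (intro cong_scalar cong_mult_right a_W IH) (use iI lJ iS in auto)
      have "(\<Sum>j\<in>I - {i}. C (?t j (I - {j})) * (col_minor (I - {j}) (J - {l}) * a j l)) \<approx>
         (\<Sum>j\<in>I - {i}. \<Sum>k\<in>J - {l}.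
      C (?s k (J - {l} - {k}) * ?t j (I - {i} - {j})) * (a i k * ?m j k * a j l))"
      proof (rule cong_sum)
        fix j assume j: "j \<in> I - {i}"
        have jS: "j \<in> S" using j less.prems by auto
        have K: "I - {j} - {i} = I - {i} - {j}" by auto
        have "?t j (I - {j}) = col_twist j i * ?t j (I - {j} - {i})"
          using fin j iI by (intro index_weight_remove) auto
        then have t: "?t j (I - {j}) = ?t j (I - {i} - {j})"
          using iI(2)[OF j] by (simp add: col_twist_def K)
        have "col_minor (I - {j}) (J - {l}) \<approx> row_minor (I - {j}) (J - {l})"
          using j lJ by (intro cong_sym[OF IH]) auto
        also have "\<dots> \<approx> (\<Sum>k\<in>J - {l}. C (?s k (J - {l} - {k})) * (a i k * row_minor (I - {j} - {i}) (J - {l} - {k})))"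
          by (rule row) (use j iI in auto)
        finally have "C (?t j (I - {j})) * (col_minor (I - {j}) (J - {l}) * a j l) \<approx>
          C (?t j (I - {j})) * ((\<Sum>k\<in>J - {l}. C (?s k (J - {l} - {k})) * (a i k * ?m j k)) * a j l)"
          unfolding K using iS jS by (intro cong_scalar cong_mult_right a_W)
        also have "\<dots> = (\<Sum>k\<in>J - {l}.
          C (?s k (J - {l} - {k}) * ?t j (I - {i} - {j})) * (a i k * ?m j k * a j l))"
          unfolding t sum_distrib_left sum_distrib_right
          by (simp add: free_scalar_mult_left mult.assoc) (simp add: mult.commute)
        finally show "C (?t j (I - {j})) * (col_minor (I - {j}) (J - {l}) * a j l) \<approx> (\<Sum>k\<in>J - {l}.
          C (?s k (J - {l} - {k}) * ?t j (I - {i} - {j})) * (a i k * ?m j k * a j l))" .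
      qed
      also have "\<dots> = D"
        unfolding D_def by (rule sum.swap)
      finally show "D \<approx> (\<Sum>j\<in>I - {i}. C (?t j (I - {j})) * (col_minor (I - {j}) (J - {l}) * a j l))"
        by (rule cong_sym)
    qed
    also have "\<dots> = (\<Sum>j\<in>I. C (?t j (I - {j})) * (col_minor (I - {j}) (J - {l}) * a j l))"
      using fin iI by (intro sum.remove[symmetric])
    also have "\<dots> \<approx> col_minor I J"
      by (rule cong_sym[OF col]) (use lJ in auto)
    finally show ?thesis .
  qed
qed

section \<open>The quantum determinant as a minor\<close>

text \<open>The scalar in \<open>\<xi>\<^sub>j\<^sub>1 \<cdots> \<xi>\<^sub>j\<^sub>r = perm_weight js \<xi>\<^sub>J\<close>.\<close>

primrec perm_weight :: "nat list \<Rightarrow> complex" where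
  "perm_weight [] = 1"
| "perm_weight (j # js) = index_weight row_twist j (set js) * perm_weight js"

lemma row_list_minor_expand:
  assumes "finite J" "card J = length is"
  shows "row.minor is 1 J = (\<Sum>js\<in>permutations_of_set J.
    C (perm_weight js) * Poly_Mapping.single (Free_Word (zip is js)) 1)"
  using assms
proof (induction "is" arbitrary: J)
  case Nil
  then show ?case
    by (simp add: row.minor_Nil flip: zero_free_word_def)
next
  case (Cons i "is")
  let ?f = "\<lambda>is js. C (perm_weight js) * Poly_Mapping.single (Free_Word (zip is js)) 1"
  have "J \<noteq> {}"
    using Cons.prems by auto
  have "row.minor (i # is) 1 J = (\<Sum>j\<in>J. \<Sum>js\<in>permutations_of_set (J - {j}). ?f (i # is) (j # js))"
    unfolding row.minor_Cons row.X_def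
  proof (rule sum.cong[OF refl])
    fix j assume j: "j \<in> J"
    have "a i j * Poly_Mapping.single (Free_Word w) 1 = Poly_Mapping.single (Free_Word ((i, j) # w)) 1" for w
      by (simp add: free_gen_def mult_single plus_free_word_def)
    moreover have "row.minor is 1 (J - {j}) = (\<Sum>js\<in>permutations_of_set (J - {j}). ?f is js)"
      using Cons j by (intro Cons.IH) auto
    ultimately show "C (index_weight row_twist j (J - {j})) * (a i j * row.minor is 1 (J - {j})) =
        (\<Sum>js\<in>permutations_of_set (J - {j}). ?f (i # is) (j # js))"
      by (auto simp: sum_distrib_left C_left(2)[of "a i j"] free_scalar_mult_left
          permutations_of_setD intro!: sum.cong)
  qed
  also have "\<dots> = (\<Sum>j\<in>J. \<Sum>js\<in>(#) j ` permutations_of_set (J - {j}). ?f (i # is) js)"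
    by (simp add: sum.reindex)
  also have "\<dots> = (\<Sum>js\<in>permutations_of_set J. ?f (i # is) js)"
    unfolding permutations_of_set_nonempty[OF \<open>J \<noteq> {}\<close>]
    by (rule sum.UNION_disjoint[symmetric]) (use Cons.prems in auto)
  finally show ?case .
qed

lemma perm_weight_map_upt:
  "inj_on \<sigma> {m..<k} \<Longrightarrow>
    perm_weight (map \<sigma> [m..<k]) = (\<Prod>i\<in>{m..<k}. \<Prod>j\<in>{i<..<k}. row_twist (\<sigma> i) (\<sigma> j))"
proof (induction "k - m" arbitrary: m)
  case (Suc d)
  then have "m < k" by simp
  then have upt: "[m..<k] = m # [Suc m..<k]" "{m..<k} = insert m {Suc m..<k}"
    by (auto simp: upt_conv_Cons)
  have "inj_on \<sigma> {Suc m..<k}"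
    using Suc.prems by (rule inj_on_subset) auto
  moreover have "{Suc m..<k} = {m<..<k}"
    by auto
  ultimately show ?case
    using Suc.hyps(1)[of "Suc m"] Suc.hyps(2)
    unfolding upt by (simp add: index_weight_def prod.reindex)
qed simp

lemma neg_weight_eq_prod:
  "neg_weight n q \<sigma> = (\<Prod>i\<in>{1..n}. \<Prod>j\<in>{i<..n}. row_twist (\<sigma> i) (\<sigma> j))"
proof -
  have fin: "finite (inversions n \<sigma>)"
    by (rule finite_subset[of _ "{1..n} \<times> {1..n}"]) (auto simp: inversions_def)
  have "neg_weight n q \<sigma> = (\<Prod>(i, j)\<in>inversions n \<sigma>. - q (\<sigma> j) (\<sigma> i))"
    unfolding neg_weight_def
    by (subst prod_constant[symmetric], subst prod.distrib[symmetric]) (auto intro!: prod.cong)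
  also have "\<dots> = (\<Prod>(i, j)\<in>inversions n \<sigma>. row_twist (\<sigma> i) (\<sigma> j))"
    by (rule prod.cong) (auto simp: inversions_def row_twist_def)
  also have "\<dots> = (\<Prod>(i, j)\<in>(SIGMA i:{1..n}. {i<..n}). row_twist (\<sigma> i) (\<sigma> j))"
    by (rule prod.mono_neutral_left) (auto simp: inversions_def row_twist_def split: if_splits)
  also have "\<dots> = (\<Prod>i\<in>{1..n}. \<Prod>j\<in>{i<..n}. row_twist (\<sigma> i) (\<sigma> j))"
    by (rule prod.Sigma[symmetric]) auto
  finally show ?thesis .
qed

lemma perm_weight_eq_neg_weight:
  assumes "\<sigma> permutes {1..n}"
  shows "perm_weight (map \<sigma> [1..<Suc n]) = neg_weight n q \<sigma>"
proof -
  have "{i<..<Suc n} = {i<..n}" for i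
    by auto
  then show ?thesis
    using perm_weight_map_upt[of \<sigma> 1 "Suc n"] permutes_inj_on[OF assms]
    unfolding neg_weight_eq_prod by (simp add: atLeastLessThanSuc_atLeastAtMost del: upt_Suc)
qed

lemma neg_weight_eq_index_weights:
  assumes "\<sigma> permutes {1..n}"
  shows "neg_weight n q \<sigma> = (\<Prod>k\<in>{1..n}. index_weight row_twist (\<sigma> k) (\<sigma> ` {k<..n}))"
  unfolding neg_weight_eq_prod index_weight_def
  by (simp add: prod.reindex permutes_inj_on[OF assms])

lemma bij_betw_permutations_of_set:
  "bij_betw (\<lambda>\<sigma>. map \<sigma> [1..<Suc n]) {\<sigma>. \<sigma> permutes {1..n}} (permutations_of_set {1..n})"
proof (rule bij_betw_imageI)
  show inj: "inj_on (\<lambda>\<sigma>. map \<sigma> [1..<Suc n]) {\<sigma>. \<sigma> permutes {1..n}}"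
  proof (rule inj_onI, rule ext)
    fix \<sigma> \<tau> x assume *: "\<sigma> \<in> {\<sigma>. \<sigma> permutes {1..n}}" "\<tau> \<in> {\<sigma>. \<sigma> permutes {1..n}}"
      "map \<sigma> [1..<Suc n] = map \<tau> [1..<Suc n]"
    show "\<sigma> x = \<tau> x"
    proof (cases "x \<in> {1..n}")
      case True
      then show ?thesis using *(3) by (auto simp del: upt_Suc)
    next
      case False
      then show ?thesis using * by (metis mem_Collect_eq permutes_not_in)
    qed
  qed
  have "(\<lambda>\<sigma>. map \<sigma> [1..<Suc n]) ` {\<sigma>. \<sigma> permutes {1..n}} \<subseteq> permutations_of_set {1..n}"
  proof safe
    fix \<sigma> assume *: "\<sigma> permutes {1..n}"
    show "map \<sigma> [1..<Suc n] \<in> permutations_of_set {1..n}"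
      using permutes_image[OF *] permutes_inj_on[OF *]
      by (auto simp: permutations_of_set_def distinct_map atLeastLessThanSuc_atLeastAtMost simp del: upt_Suc)
  qed
  then show "(\<lambda>\<sigma>. map \<sigma> [1..<Suc n]) ` {\<sigma>. \<sigma> permutes {1..n}} = permutations_of_set {1..n}"
    by (rule card_subset_eq[rotated])
      (simp_all add: card_image[OF inj] card_permutations del: upt_Suc One_nat_def)
qed

lemma row_minor_full:
  "row_minor S S = (\<Sum>\<sigma>\<in>{\<sigma>. \<sigma> permutes {1..n}}.
     C (neg_weight n q \<sigma>) * foldr (*) (map (\<lambda>i. a i (\<sigma> i)) [1..<Suc n]) 1)"
proof -
  have sorted: "sorted_list_of_set S = [1..<Suc n]"
    unfolding S_def by (simp add: sorted_list_of_set_range del: upt_Suc flip: atLeastLessThanSuc_atLeastAtMost)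
  have word: "foldr (*) (map (\<lambda>i. a i (\<sigma> i)) xs) 1
      = Poly_Mapping.single (Free_Word (zip xs (map \<sigma> xs))) (1::complex)" for \<sigma> xs
    by (induction xs) (simp_all add: free_gen_def mult_single plus_free_word_def flip: zero_free_word_def)
  have "row_minor S S = (\<Sum>js\<in>permutations_of_set S.
    C (perm_weight js) * Poly_Mapping.single (Free_Word (zip [1..<Suc n] js)) 1)"
    unfolding row_minor_def sorted by (rule row_list_minor_expand) (simp_all add: S_def)
  also have "\<dots> = (\<Sum>\<sigma>\<in>{\<sigma>. \<sigma> permutes {1..n}}. C (perm_weight (map \<sigma> [1..<Suc n])) *
      Poly_Mapping.single (Free_Word (zip [1..<Suc n] (map \<sigma> [1..<Suc n]))) 1)"
    unfolding S_def by (rule sum.reindex_bij_betw[OF bij_betw_permutations_of_set, symmetric])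
  also have "\<dots> = (\<Sum>\<sigma>\<in>{\<sigma>. \<sigma> permutes {1..n}}.
     C (neg_weight n q \<sigma>) * foldr (*) (map (\<lambda>i. a i (\<sigma> i)) [1..<Suc n]) 1)"
    by (rule sum.cong) (simp_all add: perm_weight_eq_neg_weight word del: upt_Suc One_nat_def)
  finally show ?thesis .
qed

text \<open>Permutations of \<open>{1..n}\<close> correspond to the orderings of the columns, with \<open>(-q)\<^sub>\<sigma>\<close> as the weight of the
  ordering.\<close>

lemma coset_of_full_minor: "N +>\<^bsub>qmat_free n\<^esub> row_minor S S = qdet n p q"
proof -
  let ?Q = "qmat_algebra n p q"
  define \<pi> where "\<pi> f = N +>\<^bsub>qmat_free n\<^esub> f" for f
  let ?f = "\<lambda>\<sigma>. foldr (*) (map (\<lambda>i. a i (\<sigma> i)) [1..<Suc n]) 1"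
  let ?g = "\<lambda>\<sigma>. foldr (mult ?Q) (map (\<lambda>i. qmat_gen n p q i (\<sigma> i)) [1..<Suc n]) \<one>\<^bsub>?Q\<^esub>"
  interpret Q: ring ?Q
    unfolding qmat_algebra_def by (rule N.quotient_is_ring)
  have hom: "\<pi> \<in> ring_hom (qmat_free n) ?Q"
    unfolding \<pi>_def[abs_def] qmat_algebra_def by (rule N.rcos_ring_hom)
  have closed: "\<pi> x \<in> carrier ?Q" if "x \<in> W" for x
    using ring_hom_closed[OF hom] that by (simp add: W_def)
  have add: "\<pi> (x + y) = \<pi> x \<oplus>\<^bsub>?Q\<^esub> \<pi> y" and mult: "\<pi> (x * y) = \<pi> x \<otimes>\<^bsub>?Q\<^esub> \<pi> y"
    if "x \<in> W" "y \<in> W" for x y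
    using ring_hom_add[OF hom] ring_hom_mult[OF hom] that by (simp_all add: W_def)
  have sum: "\<pi> (\<Sum>t\<in>T. f t) = (\<Oplus>\<^bsub>?Q\<^esub>t\<in>T. \<pi> (f t))" if "\<And>t. t \<in> T \<Longrightarrow> f t \<in> W" for T :: "(nat \<Rightarrow> nat) set" and f
  proof -
    have "\<pi> 0 = \<zero>\<^bsub>?Q\<^esub>"
      using ring_hom_zero[OF hom W.ring_axioms Q.ring_axioms] by simp
    then show ?thesis
      using that
    proof (induction T rule: infinite_finite_induct)
      case (insert t T)
      then have "\<pi> (f t + sum f T) = \<pi> (f t) \<oplus>\<^bsub>?Q\<^esub> \<pi> (sum f T)"
        by (intro add free.subspace_sum[OF subspace_W]) auto
      with insert show ?case
        by (simp add: Q.finsum_insert closed)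
    qed simp_all
  qed
  have word: "foldr (*) (map (\<lambda>i. a i (\<sigma> i)) xs) 1 \<in> W
      \<and> \<pi> (foldr (*) (map (\<lambda>i. a i (\<sigma> i)) xs) 1) = foldr (mult ?Q) (map (\<lambda>i. qmat_gen n p q i (\<sigma> i)) xs) \<one>\<^bsub>?Q\<^esub>"
    if \<sigma>: "\<sigma> permutes {1..n}" and "set xs \<subseteq> S" for \<sigma> xs
    using that(2)
  proof (induction xs)
    case Nil
    then show ?case using ring_hom_one[OF hom] by simp
  next
    case (Cons i xs)
    have "i \<in> S" "\<sigma> i \<in> S"
      using Cons.prems permutes_in_image[OF \<sigma>, of i] by (auto simp: S_def)
    then have "a i (\<sigma> i) \<in> W"
      by (rule a_W)
    moreover have "\<pi> (a i (\<sigma> i)) = qmat_gen n p q i (\<sigma> i)"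
      by (simp add: \<pi>_def qmat_gen_def)
    ultimately show ?case
      using Cons by (simp add: mult mult_W)
  qed
  have f: "?f \<sigma> \<in> W" "\<pi> (?f \<sigma>) = ?g \<sigma>" if "\<sigma> permutes {1..n}" for \<sigma>
  proof -
    have "set [1..<Suc n] \<subseteq> S"
      by (auto simp: S_def)
    from word[OF that this] show "?f \<sigma> \<in> W" "\<pi> (?f \<sigma>) = ?g \<sigma>"
      by blast+
  qed
  have weighted: "\<pi> (C (neg_weight n q \<sigma>) * ?f \<sigma>) = qmat_scalar n p q (neg_weight n q \<sigma>) \<otimes>\<^bsub>?Q\<^esub> ?g \<sigma>"
    if "\<sigma> permutes {1..n}" for \<sigma>
    by (simp only: mult[OF C_W f(1)[OF that]] f(2)[OF that]) (simp only: \<pi>_def qmat_scalar_def)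
  have "\<pi> (row_minor S S) = (\<Oplus>\<^bsub>?Q\<^esub>\<sigma>\<in>{\<sigma>. \<sigma> permutes {1..n}}. \<pi> (C (neg_weight n q \<sigma>) * ?f \<sigma>))"
    unfolding row_minor_full by (rule sum) (use f(1) in \<open>blast intro: mult_W C_W\<close>)
  also have "\<dots> = qdet n p q"
    unfolding qdet_def ordered_prod_def
  proof (rule Q.finsum_cong'[OF refl])
    show "(\<lambda>\<sigma>. qmat_scalar n p q (neg_weight n q \<sigma>) \<otimes>\<^bsub>?Q\<^esub> ?g \<sigma>) \<in> {\<sigma>. \<sigma> permutes {1..n}} \<rightarrow> carrier ?Q"
    proof
      fix \<sigma> assume "\<sigma> \<in> {\<sigma>. \<sigma> permutes {1..n}}"
      then have \<sigma>: "\<sigma> permutes {1..n}" by blast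
      show "qmat_scalar n p q (neg_weight n q \<sigma>) \<otimes>\<^bsub>?Q\<^esub> ?g \<sigma> \<in> carrier ?Q"
        unfolding weighted[OF \<sigma>, symmetric] by (intro closed mult_W C_W f \<sigma>)
    qed
  qed (use weighted in blast)
  finally show ?thesis
    by (simp add: \<pi>_def)
qed

section \<open>Minors are nonzero\<close>

text \<open>For a set \<open>P\<close> of positions that increase in both coordinates, let \<open>z\<^sub>x\<close>, \<open>x \<in> P\<close>, be variables with
  \<open>z\<^sub>x z\<^sub>y = monomial_twist x y z\<^sub>y z\<^sub>x\<close> whenever \<open>x\<close> lies above \<open>y\<close>. Sending \<open>a\<^sub>i\<^sub>j\<close> to \<open>z\<^sub>(\<^sub>i\<^sub>,\<^sub>j\<^sub>)\<close> for positions
  in \<open>P\<close> and to \<open>0\<close> otherwise respects the relations.\<close>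

definition monomial_twist :: "nat \<times> nat \<Rightarrow> nat \<times> nat \<Rightarrow> complex" where
  "monomial_twist x y =
     (if fst x < fst y then q (snd x) (snd y) / q (fst x) (fst y) else 1)"

text \<open>The coefficient of the image of a word, with respect to the variables sorted from bottom to top.\<close>

primrec monomial_value :: "(nat \<times> nat) set \<Rightarrow> (nat \<times> nat) list \<Rightarrow> complex" where
  "monomial_value P [] = 1"
| "monomial_value P (x # w) =
     (if x \<in> P then prod_list (map (monomial_twist x) w) * monomial_value P w else 0)"

lemma monomial_value_append:
  "monomial_value P (u @ v) = monomial_value P u * monomial_value P v
     * prod_list (map (\<lambda>x. prod_list (map (monomial_twist x) v)) u)"
  by (induction u) simp_all

text \<open>All factors except the last are symmetric in \<open>x\<close> and \<open>y\<close>, so that exchanging two neighbours only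
  exchanges \<open>monomial_twist x y\<close> for \<open>monomial_twist y x\<close>.\<close>

lemma monomial_value_adjacent:
  "monomial_value P (u @ x # y # v) = monomial_value P u * monomial_value P v
     * prod_list (map (\<lambda>x. prod_list (map (monomial_twist x) v)) u)
     * (prod_list (map (\<lambda>z. monomial_twist z x) u) * prod_list (map (\<lambda>z. monomial_twist z y) u))
     * (prod_list (map (monomial_twist x) v) * prod_list (map (monomial_twist y) v))
     * (if x \<in> P \<and> y \<in> P then monomial_twist x y else 0)"
proof -
  have "prod_list (map (\<lambda>z. f z * g z) u) = prod_list (map f u) * prod_list (map g u)"
    for f g :: "nat \<times> nat \<Rightarrow> complex"
    by (induction u) simp_all
  then show ?thesis
    by (simp add: monomial_value_append mult_ac)
qed

text \<open>Two positions in one row or column, or one above and to the right of the other, never lie in \<open>P\<close>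
  together, so each relation reduces to the commutation of \<open>a\<^sub>i\<^sub>k\<close> and \<open>a\<^sub>j\<^sub>l\<close>, \<open>i < j\<close>, \<open>k < l\<close>.\<close>

lemma monomial_value_relation:
  assumes incr: "\<And>i j k l. (i, k) \<in> P \<Longrightarrow> (j, l) \<in> P \<Longrightarrow> i < j \<longleftrightarrow> k < l"
    and r: "r \<in> qmat_relations n p q"
  shows "word_functional (monomial_value P)
    (Poly_Mapping.single (Free_Word u) 1 * r * Poly_Mapping.single (Free_Word v) 1) = 0"
proof -
  let ?L = "word_functional (monomial_value P)"
  let ?U = "Poly_Mapping.single (Free_Word u) (1::complex)"
  let ?V = "Poly_Mapping.single (Free_Word v) (1::complex)"
  have L_diff: "?L (x - y) = ?L x - ?L y" for x y
    using word_functional_add[of "monomial_value P" "x - y" y] by simp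
  have word: "?U * (C z * free_gen x * free_gen y) * ?V
      = Poly_Mapping.single (Free_Word (u @ x # y # v)) z" for x y z
    by (simp add: free_gen_def free_scalar_def mult_single plus_free_word_def zero_free_word_def)
  have L1: "?L (?U * (C z * free_gen x * free_gen y) * ?V) = z * monomial_value P (u @ x # y # v)" for x y z
    unfolding word by (simp add: word_functional_single)
  have L2: "?L (?U * (free_gen x * free_gen y) * ?V) = monomial_value P (u @ x # y # v)" for x y
    using L1[of 1] by simp
  have swap: "monomial_value P (u @ x # y # v) = z * monomial_value P (u @ y # x # v)"
    if "x \<in> P \<Longrightarrow> y \<in> P \<Longrightarrow> monomial_twist x y = z * monomial_twist y x" for x y z
    using that by (simp add: monomial_value_adjacent)
  have zero: "monomial_value P (u @ x # y # v) = 0" "monomial_value P (u @ y # x # v) = 0"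
    if "x \<notin> P \<or> y \<notin> P" for x y
    using that by (auto simp: monomial_value_adjacent)
  consider (row) i k l where "r = a i k * a i l - C (q k l) * a i l * a i k" "k < l"
    | (col) i j k where "r = a i k * a j k - C (p i j) * a j k * a i k" "i < j"
    | (q) i j k l where "r = (a i k * a j l - C (q k l / q i j) * a j l * a i k)
          - (C (q k l) * a i l * a j k - C (1 / q i j) * a j k * a i l)"
        "i \<in> S" "j \<in> S" "k \<in> S" "l \<in> S" "i < j" "k < l"
    | (p) i j k l where "r = (a i k * a j l - C (p i j / p k l) * a j l * a i k)
          - (C (p i j) * a j k * a i l - C (1 / p k l) * a i l * a j k)"
        "i \<in> S" "j \<in> S" "k \<in> S" "l \<in> S" "i < j" "k < l"
    using r unfolding qmat_relations_def Let_def S_def[symmetric] by blast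
  then show ?thesis
  proof cases
    case row
    then have disj: "(i, k) \<notin> P \<or> (i, l) \<notin> P"
      using incr[of i k i l] by auto
    from row show ?thesis
      using zero[of "(i, k)" "(i, l)", OF disj] by (simp add: right_diff_distrib left_diff_distrib L_diff L1 L2)
  next
    case col
    then have disj: "(i, k) \<notin> P \<or> (j, k) \<notin> P"
      using incr[of i k j k] by auto
    from col show ?thesis
      using zero[of "(i, k)" "(j, k)", OF disj] by (simp add: right_diff_distrib left_diff_distrib L_diff L1 L2)
  next
    case q
    then have disj: "(i, l) \<notin> P \<or> (j, k) \<notin> P"
      using incr[of i l j k] by auto
    have "monomial_value P (u @ (i, k) # (j, l) # v) = q k l / q i j * monomial_value P (u @ (j, l) # (i, k) # v)"
      by (rule swap) (use q in \<open>simp add: monomial_twist_def\<close>)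
    then show ?thesis
      using q(1) zero[of "(i, l)" "(j, k)", OF disj] by (simp add: right_diff_distrib left_diff_distrib L_diff L1 L2)
  next
    case p
    then have disj: "(i, l) \<notin> P \<or> (j, k) \<notin> P"
      using incr[of i l j k] by auto
    from p have "q k l / q i j = p i j / p k l"
      using pq_lam[of i j] pq_lam[of k l] p_nz[of k l] q_nz[of i j] by (simp add: field_simps)
    then have "monomial_value P (u @ (i, k) # (j, l) # v) = p i j / p k l * monomial_value P (u @ (j, l) # (i, k) # v)"
      by (intro swap) (use p in \<open>simp add: monomial_twist_def\<close>)
    then show ?thesis
      using p(1) zero[of "(i, l)" "(j, k)", OF disj] by (simp add: right_diff_distrib left_diff_distrib L_diff L1 L2)
  qed
qed

lemma index_weight_nz: "j \<in> S \<Longrightarrow> K \<subseteq> S \<Longrightarrow> index_weight row_twist j K \<noteq> 0" "j \<in> S \<Longrightarrow> K \<subseteq> S \<Longrightarrow> index_weight col_twist j K \<noteq> 0"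
  unfolding index_weight_def using twist_nz finite_subset_S[of K] by (auto simp: prod_zero_iff)

lemma perm_weight_nz: "set js \<subseteq> S \<Longrightarrow> perm_weight js \<noteq> 0"
  by (induction js) (auto simp: index_weight_nz)

lemma monomial_value_nz: "set w \<subseteq> P \<Longrightarrow> P \<subseteq> S \<times> S \<Longrightarrow> monomial_value P w \<noteq> 0"
proof (induction w)
  case (Cons x w)
  have "monomial_twist x y \<noteq> 0" if "y \<in> set w" for y
  proof -
    have "x \<in> S \<times> S" "y \<in> S \<times> S" using Cons.prems that by auto
    then show ?thesis by (auto simp: monomial_twist_def q_nz)
  qed
  then show ?case
    using Cons by (auto simp: prod_list_zero_iff)
qed simp

lemma monomial_value_eq_0: "\<not> set w \<subseteq> P \<Longrightarrow> monomial_value P w = 0"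
  by (induction w) auto

text \<open>Match \<open>I\<close> with \<open>J\<close> increasingly. Then the functional kills every summand of the minor except the one
  that belongs to the increasing ordering of the columns.\<close>

lemma row_minor_notin_N:
  assumes "I \<subseteq> S" "J \<subseteq> S" "card I = card J"
  shows "row_minor I J \<notin> N"
proof
  assume N: "row_minor I J \<in> N"
  let ?is = "sorted_list_of_set I" and ?js = "sorted_list_of_set J"
  define P where "P = set (zip ?is ?js)"
  have fin: "finite I" "finite J"
    using assms finite_subset_S by auto
  have len: "length ?is = card I" "length ?js = card I"
    using assms by simp_all
  have P: "x \<in> P \<longleftrightarrow> (\<exists>t < card I. x = (?is ! t, ?js ! t))" for x
    unfolding P_def set_zip using len by auto
  have mono: "?is ! s < ?is ! t \<longleftrightarrow> s < t" "?js ! s < ?js ! t \<longleftrightarrow> s < t" if "s < card I" "t < card I" for s t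
    using that len strict_sorted_list_of_set[of I] strict_sorted_list_of_set[of J]
    by (metis sorted_wrt_nth_less linorder_neqE_nat order_less_asym order_less_irrefl)+
  have incr: "i < j \<longleftrightarrow> k < l" if "(i, k) \<in> P" "(j, l) \<in> P" for i j k l
    using that mono unfolding P by auto
  have PS: "P \<subseteq> S \<times> S"
  proof (rule subrelI)
    fix i k assume "(i, k) \<in> P"
    then have "i \<in> set ?is" "k \<in> set ?js"
      unfolding P_def by (blast dest: set_zip_leftD set_zip_rightD)+
    then show "(i, k) \<in> S \<times> S"
      using assms fin by auto
  qed
  have other: "monomial_value P (zip ?is js) = 0" if "js \<in> permutations_of_set J - {?js}" for js
  proof (rule monomial_value_eq_0)
    have js: "length js = card I" "js \<noteq> ?js"
      using that assms by (auto simp: length_finite_permutations_of_set)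
    then obtain t where t: "t < card I" "js ! t \<noteq> ?js ! t"
      using len by (auto simp: list_eq_iff_nth_eq)
    then have "(?is ! t, js ! t) \<in> set (zip ?is js)"
      using js len by (auto simp: set_zip)
    moreover have "(?is ! t, js ! t) \<notin> P"
      using t len by (auto simp: P nth_eq_iff_index_eq)
    ultimately show "\<not> set (zip ?is js) \<subseteq> P" by blast
  qed
  have "word_functional (monomial_value P) (row_minor I J)
     = (\<Sum>js\<in>permutations_of_set J. perm_weight js * monomial_value P (zip ?is js))"
  proof -
    have "row_minor I J = (\<Sum>js\<in>permutations_of_set J.
        C (perm_weight js) * Poly_Mapping.single (Free_Word (zip ?is js)) 1)"
      unfolding row_minor_def using fin assms by (intro row_list_minor_expand) auto
    also have "\<dots> = (\<Sum>js\<in>permutations_of_set J.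
        Poly_Mapping.single (Free_Word (zip ?is js)) (perm_weight js))"
      by (simp add: free_scalar_def mult_single)
    finally show ?thesis
      by (simp add: word_functional_sum word_functional_single)
  qed
  also have "\<dots> = (\<Sum>js\<in>{?js}. perm_weight js * monomial_value P (zip ?is js))"
    by (rule sum.mono_neutral_right) (use fin other in \<open>auto intro: permutations_of_setI\<close>)
  also have "\<dots> \<noteq> 0"
    using perm_weight_nz[of ?js] monomial_value_nz[of "zip ?is ?js" P] PS assms fin by (simp add: P_def)
  finally have "word_functional (monomial_value P) (row_minor I J) \<noteq> 0" .
  moreover have "word_functional (monomial_value P) (row_minor I J) = 0"
  proof (rule genideal_le_sandwich_kernel[OF relations_W[unfolded W_def]])
    show "row_minor I J \<in> Idl\<^bsub>qmat_free n\<^esub> qmat_relations n p q"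
      using N by (simp add: qmat_ideal_def)
  qed (rule monomial_value_relation[OF incr])
  ultimately show False by contradiction
qed

end

section \<open>Two-sided inverses over a noncommutative ring\<close>

lemma (in abelian_monoid) finsum_swap:
  assumes "finite A" "finite B" "\<And>x y. x \<in> A \<Longrightarrow> y \<in> B \<Longrightarrow> f x y \<in> carrier G"
  shows "(\<Oplus>x\<in>A. \<Oplus>y\<in>B. f x y) = (\<Oplus>y\<in>B. \<Oplus>x\<in>A. f x y)"
  using assms(1,3)
proof (induction A rule: finite_induct)
  case (insert x A)
  have "(\<Oplus>x\<in>insert x A. \<Oplus>y\<in>B. f x y) = (\<Oplus>y\<in>B. f x y) \<oplus> (\<Oplus>x\<in>A. \<Oplus>y\<in>B. f x y)"
    using insert by (intro finsum_insert) auto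
  also have "\<dots> = (\<Oplus>y\<in>B. f x y) \<oplus> (\<Oplus>y\<in>B. \<Oplus>x\<in>A. f x y)"
    using insert by simp
  also have "\<dots> = (\<Oplus>y\<in>B. f x y \<oplus> (\<Oplus>x\<in>A. f x y))"
    using insert.prems by (intro finsum_addf[symmetric]) auto
  also have "\<dots> = (\<Oplus>y\<in>B. \<Oplus>x\<in>insert x A. f x y)"
    using insert by (intro finsum_cong' refl) (auto simp: finsum_insert Pi_def)
  finally show ?case .
qed (simp add: finsum_zero)

text \<open>The usual \<open>L = L (X Y) = (L X) Y = Y\<close>.\<close>

lemma (in ring) left_matrix_inverse_eq_right_inverse:
  assumes fin: "finite I" "finite J"
    and X: "\<And>i j. i \<in> I \<Longrightarrow> j \<in> J \<Longrightarrow> X i j \<in> carrier R"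
    and Lc: "\<And>i j. i \<in> I \<Longrightarrow> j \<in> J \<Longrightarrow> L j i \<in> carrier R"
    and Yc: "\<And>i j. i \<in> I \<Longrightarrow> j \<in> J \<Longrightarrow> Y j i \<in> carrier R"
    and L: "\<And>j j'. j \<in> J \<Longrightarrow> j' \<in> J \<Longrightarrow> (\<Oplus>i\<in>I. L j i \<otimes> X i j') = (if j = j' then \<one> else \<zero>)"
    and Y: "\<And>i i'. i \<in> I \<Longrightarrow> i' \<in> I \<Longrightarrow> (\<Oplus>j\<in>J. X i j \<otimes> Y j i') = (if i = i' then \<one> else \<zero>)"
    and ij: "i \<in> I" "j \<in> J"
  shows "L j i = Y j i"
proof -
  have "L j i = (\<Oplus>i'\<in>I. if i' = i then L j i' else \<zero>)"
    using add.finprod_singleton_swap[of i I "L j"] fin ij Lc by simp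
  also have "\<dots> = (\<Oplus>i'\<in>I. L j i' \<otimes> (\<Oplus>j'\<in>J. X i' j' \<otimes> Y j' i))"
    using ij Lc Y by (intro finsum_cong' refl) (auto simp: Pi_def)
  also have "\<dots> = (\<Oplus>i'\<in>I. \<Oplus>j'\<in>J. L j i' \<otimes> (X i' j' \<otimes> Y j' i))"
    using ij Lc X Yc fin by (intro finsum_cong' refl finsum_rdistr) (auto simp: Pi_def)
  also have "\<dots> = (\<Oplus>j'\<in>J. \<Oplus>i'\<in>I. L j i' \<otimes> (X i' j' \<otimes> Y j' i))"
    using ij Lc X Yc fin by (intro finsum_swap) auto
  also have "\<dots> = (\<Oplus>j'\<in>J. (\<Oplus>i'\<in>I. L j i' \<otimes> X i' j') \<otimes> Y j' i)"
    using ij Lc X Yc fin by (intro finsum_cong' refl) (auto simp: Pi_def finsum_ldistr m_assoc intro!: finsum_cong')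
  also have "\<dots> = (\<Oplus>j'\<in>J. if j' = j then Y j' i else \<zero>)"
    using ij Yc L by (intro finsum_cong' refl) (auto simp: Pi_def)
  also have "\<dots> = Y j i"
    using add.finprod_singleton_swap[of j J "\<lambda>j'. Y j' i"] fin ij Yc by simp
  finally show ?thesis .
qed

lemma (in monoid) commute_inv:
  assumes "x \<in> carrier G" "y \<in> Units G" "x \<otimes> y = y \<otimes> x"
  shows "x \<otimes> inv y = inv y \<otimes> x"
proof -
  have y: "y \<in> carrier G" "inv y \<in> carrier G"
    using assms by auto
  have "x \<otimes> inv y = inv y \<otimes> (y \<otimes> x) \<otimes> inv y"
    using assms y by (simp flip: m_assoc)
  also have "\<dots> = inv y \<otimes> (x \<otimes> (y \<otimes> inv y))"
    using assms y by (simp add: m_assoc flip: assms(3))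
  finally show ?thesis
    using assms y by simp
qed

lemma (in monoid) commute_mult:
  assumes "x \<in> carrier G" "y \<in> carrier G" "z \<in> carrier G" "x \<otimes> y = y \<otimes> x" "x \<otimes> z = z \<otimes> x"
  shows "x \<otimes> (y \<otimes> z) = y \<otimes> z \<otimes> x"
  using assms by (metis m_assoc)

section \<open>Quasideterminants as quotients of minors\<close>

text \<open>The homomorphism \<open>h\<close> stands for the composition of the canonical maps from the free algebra to the
  skew field of fractions. By the condition on its kernel, identities modulo the ideal of relations are
  the same as identities between images in the skew field, and elements outside the ideal become
  invertible.\<close>

locale quantum_fractions = quantum_matrix +
  fixes D :: "'d ring" (structure) and h
  assumes skew: "skew_field D"
    and h_hom: "h \<in> ring_hom (qmat_free n) D"
    and h_kernel: "x \<in> W \<Longrightarrow> h x = \<zero> \<longleftrightarrow> x \<in> N"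
begin

sublocale D: ring D
  using skew by (simp add: skew_field_def)

lemma h_closed [simp]: "x \<in> W \<Longrightarrow> h x \<in> carrier D"
  using ring_hom_closed[OF h_hom] by (simp add: W_def)

lemma h_mult: "x \<in> W \<Longrightarrow> y \<in> W \<Longrightarrow> h (x * y) = h x \<otimes> h y"
  using ring_hom_mult[OF h_hom] by (simp add: W_def)

lemma h_add: "x \<in> W \<Longrightarrow> y \<in> W \<Longrightarrow> h (x + y) = h x \<oplus> h y"
  using ring_hom_add[OF h_hom] by (simp add: W_def)

lemma h_1 [simp]: "h 1 = \<one>"
  using ring_hom_one[OF h_hom] by simp

lemma h_0 [simp]: "h 0 = \<zero>"
  using h_kernel[of 0] free.subspace_0[OF subspace_N] free.subspace_0[OF subspace_W] by simp

lemma h_sum: "(\<And>t. t \<in> T \<Longrightarrow> f t \<in> W) \<Longrightarrow> h (\<Sum>t\<in>T. f t) = (\<Oplus>t\<in>T. h (f t))"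
  by (induction T rule: infinite_finite_induct)
    (auto simp: D.finsum_insert h_add free.subspace_sum[OF subspace_W])

lemma cong_iff: "x \<in> W \<Longrightarrow> y \<in> W \<Longrightarrow> x \<approx> y \<longleftrightarrow> h x = h y"
proof -
  assume xy: "x \<in> W" "y \<in> W"
  have d: "x - y \<in> W"
    using xy free.subspace_diff[OF subspace_W] by blast
  then have "h x = h (x - y) \<oplus> h y"
    using h_add[of "x - y" y] xy by simp
  then show "x \<approx> y \<longleftrightarrow> h x = h y"
    using h_kernel[OF d] xy d D.add.r_cancel_one'[of "h y" "h (x - y)"]
    by (auto simp: cong_def)
qed

abbreviation M :: "nat set \<Rightarrow> nat set \<Rightarrow> 'd" where "M I J \<equiv> h (row_minor I J)"
abbreviation A :: "nat \<Rightarrow> nat \<Rightarrow> 'd" where "A i j \<equiv> h (a i j)"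

lemma units_iff: "x \<in> Units D \<longleftrightarrow> x \<in> carrier D \<and> x \<noteq> \<zero>"
  using skew by (auto simp: skew_field_def)

lemma M_unit: "I \<subseteq> S \<Longrightarrow> J \<subseteq> S \<Longrightarrow> card I = card J \<Longrightarrow> M I J \<in> Units D"
  using row_minor_notin_N[of I J] h_kernel row_minor_W by (simp add: units_iff)

text \<open>The weights are those of the two Laplace expansions, divided by the weight of the expanded minor.\<close>

definition row_adjugate :: "nat set \<Rightarrow> nat set \<Rightarrow> nat \<Rightarrow> nat \<Rightarrow> (nat \<times> nat) free_word \<Rightarrow>\<^sub>0 complex" where
  "row_adjugate I J j i =
     C (index_weight row_twist j (J - {j}) / index_weight row_twist i (I - {i}))
       * row_minor (I - {i}) (J - {j})"

definition col_adjugate :: "nat set \<Rightarrow> nat set \<Rightarrow> nat \<Rightarrow> nat \<Rightarrow> (nat \<times> nat) free_word \<Rightarrow>\<^sub>0 complex" where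
  "col_adjugate I J j i =
     C (index_weight col_twist i (I - {i}) / index_weight col_twist j (J - {j}))
       * row_minor (I - {i}) (J - {j})"

lemma adjugate_W:
  assumes "I \<subseteq> S" "J \<subseteq> S"
  shows "row_adjugate I J j i \<in> W" "col_adjugate I J j i \<in> W"
  unfolding row_adjugate_def col_adjugate_def
  using assms by (auto intro!: mult_W row_minor_W)

lemma matrix_mult_row_adjugate:
  assumes "I \<subseteq> S" "J \<subseteq> S" "i \<in> I" "i' \<in> I"
  shows "(\<Sum>j\<in>J. a i' j * row_adjugate I J j i) \<approx> (if i' = i then row_minor I J else 0)"
proof -
  let ?s = "index_weight row_twist i (I - {i})"
  have nz: "?s \<noteq> 0"
    by (rule index_weight_nz) (use assms in auto)
  have "(\<Sum>j\<in>J. a i' j * row_adjugate I J j i) = C (1 / ?s) *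
     (\<Sum>j\<in>J. C (index_weight row_twist j (J - {j})) * (a i' j * row_minor (I - {i}) (J - {j})))"
    by (simp add: row_adjugate_def C_left(2)[of "a _ _"] sum_distrib_left free_scalar_mult_left)
  also have "\<dots> \<approx> C (1 / ?s) * (if i' = i then C ?s * row_minor I J else 0)"
    by (rule cong_scalar[OF row_expansion[OF assms]])
  also have "\<dots> = (if i' = i then row_minor I J else 0)"
    using nz by (simp add: free_scalar_mult_left)
  finally show ?thesis .
qed

lemma col_adjugate_mult_matrix:
  assumes "I \<subseteq> S" "J \<subseteq> S" "card I = card J" "j \<in> J" "j' \<in> J"
  shows "(\<Sum>i\<in>I. col_adjugate I J j i * a i j') \<approx> (if j = j' then row_minor I J else 0)"
proof -
  let ?t = "index_weight col_twist j (J - {j})"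
  have nz: "?t \<noteq> 0"
    by (rule index_weight_nz) (use assms in auto)
  have fin: "finite I" "finite J"
    using assms finite_subset_S by auto
  have eq: "(\<Sum>i\<in>I. col_adjugate I J j i * a i j') = C (1 / ?t) *
     (\<Sum>i\<in>I. C (index_weight col_twist i (I - {i})) * (row_minor (I - {i}) (J - {j}) * a i j'))"
    by (simp add: col_adjugate_def sum_distrib_left free_scalar_mult_left mult.assoc)
  have "C (1 / ?t) *
     (\<Sum>i\<in>I. C (index_weight col_twist i (I - {i})) * (row_minor (I - {i}) (J - {j}) * a i j')) \<approx> C (1 / ?t) *
     (\<Sum>i\<in>I. C (index_weight col_twist i (I - {i})) * (col_minor (I - {i}) (J - {j}) * a i j'))"
    by (intro cong_scalar cong_sum cong_mult_right a_W row_minor_cong_col_minor) (use assms fin in auto)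
  also have "\<dots> \<approx> C (1 / ?t) * (if j' = j then C ?t * col_minor I J else 0)"
    by (rule cong_scalar[OF col_expansion[OF assms(1,2,4,5)]])
  also have "\<dots> = (if j = j' then col_minor I J else 0)"
    using nz by (auto simp: free_scalar_mult_left)
  also have "\<dots> \<approx> (if j = j' then row_minor I J else 0)"
    using cong_sym[OF row_minor_cong_col_minor] assms by auto
  finally show ?thesis
    unfolding eq .
qed

lemma right_inverse:
  assumes "I \<subseteq> S" "J \<subseteq> S" "card I = card J" "i \<in> I" "i' \<in> I"
  shows "(\<Oplus>j\<in>J. A i j \<otimes> (h (row_adjugate I J j i') \<otimes> inv (M I J))) = (if i = i' then \<one> else \<zero>)"
proof -
  have M: "M I J \<in> Units D"
    using assms by (intro M_unit)
  have aW: "a i j \<in> W" if "j \<in> J" for j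
    using assms that by (intro a_W) auto
  have "(\<Oplus>j\<in>J. A i j \<otimes> (h (row_adjugate I J j i') \<otimes> inv (M I J)))
      = (\<Oplus>j\<in>J. h (a i j * row_adjugate I J j i') \<otimes> inv (M I J))"
    using assms aW adjugate_W[of I J] M by (intro D.finsum_cong' refl) (auto simp: Pi_def h_mult mult_W D.m_assoc)
  also have "\<dots> = (\<Oplus>j\<in>J. h (a i j * row_adjugate I J j i')) \<otimes> inv (M I J)"
    using assms aW adjugate_W[of I J] M finite_subset_S[of J]
    by (intro D.finsum_ldistr[symmetric]) (auto simp: Pi_def mult_W)
  also have "(\<Oplus>j\<in>J. h (a i j * row_adjugate I J j i')) = h (\<Sum>j\<in>J. a i j * row_adjugate I J j i')"
    using assms aW adjugate_W[of I J] by (intro h_sum[symmetric]) (auto intro: mult_W)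
  also have "\<dots> = h (if i = i' then row_minor I J else 0)"
    using matrix_mult_row_adjugate[of I J i' i] assms aW adjugate_W[of I J] row_minor_W[of I J]
      free.subspace_0[OF subspace_W]
    by (subst (asm) cong_iff) (auto intro!: mult_W free.subspace_sum[OF subspace_W])
  finally show ?thesis
    using M D.Units_r_inv[OF M] by auto
qed

lemma left_inverse:
  assumes "I \<subseteq> S" "J \<subseteq> S" "card I = card J" "j \<in> J" "j' \<in> J"
  shows "(\<Oplus>i\<in>I. inv (M I J) \<otimes> h (col_adjugate I J j i) \<otimes> A i j') = (if j = j' then \<one> else \<zero>)"
proof -
  have M: "M I J \<in> Units D"
    using assms by (intro M_unit)
  have aW: "a i j' \<in> W" if "i \<in> I" for i
    using assms that by (intro a_W) auto
  have "(\<Oplus>i\<in>I. inv (M I J) \<otimes> h (col_adjugate I J j i) \<otimes> A i j')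
      = (\<Oplus>i\<in>I. inv (M I J) \<otimes> h (col_adjugate I J j i * a i j'))"
    using assms aW adjugate_W[of I J] M by (intro D.finsum_cong' refl) (auto simp: Pi_def h_mult mult_W D.m_assoc)
  also have "\<dots> = inv (M I J) \<otimes> (\<Oplus>i\<in>I. h (col_adjugate I J j i * a i j'))"
    using assms aW adjugate_W[of I J] M finite_subset_S[of I]
    by (intro D.finsum_rdistr[symmetric]) (auto simp: Pi_def mult_W)
  also have "(\<Oplus>i\<in>I. h (col_adjugate I J j i * a i j')) = h (\<Sum>i\<in>I. col_adjugate I J j i * a i j')"
    using assms aW adjugate_W[of I J] by (intro h_sum[symmetric]) (auto intro: mult_W)
  also have "\<dots> = h (if j = j' then row_minor I J else 0)"
    using col_adjugate_mult_matrix[of I J j j'] assms aW adjugate_W[of I J] row_minor_W[of I J]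
      free.subspace_0[OF subspace_W]
    by (subst (asm) cong_iff) (auto intro!: mult_W free.subspace_sum[OF subspace_W])
  finally show ?thesis
    using M D.Units_l_inv[OF M] by auto
qed

text \<open>Both sides invert the submatrix, one from the left and one from the right.\<close>

lemma adjugates_agree:
  assumes "I \<subseteq> S" "J \<subseteq> S" "card I = card J" "i \<in> I" "j \<in> J"
  shows "inv (M I J) \<otimes> h (col_adjugate I J j i) = h (row_adjugate I J j i) \<otimes> inv (M I J)"
proof (rule D.left_matrix_inverse_eq_right_inverse[of I J A])
  have M: "M I J \<in> Units D"
    using assms by (intro M_unit)
  show "finite I" "finite J"
    using assms finite_subset_S by auto
  fix i j assume ij: "i \<in> I" "j \<in> J"
  show "A i j \<in> carrier D"
    using assms ij by (intro h_closed a_W) auto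
  show "inv (M I J) \<otimes> h (col_adjugate I J j i) \<in> carrier D"
    "h (row_adjugate I J j i) \<otimes> inv (M I J) \<in> carrier D"
    using assms M adjugate_W[of I J] by auto
qed (use assms left_inverse right_inverse in auto)

lemma matrix_inverse:
  assumes "I \<subseteq> S" "J \<subseteq> S" "card I = card J"
  shows "is_matrix_inverse D I J A (\<lambda>j i. h (row_adjugate I J j i) \<otimes> inv (M I J))"
  unfolding is_matrix_inverse_def
proof (intro conjI ballI)
  have M: "M I J \<in> Units D"
    using assms by (intro M_unit)
  show "h (row_adjugate I J j i) \<otimes> inv (M I J) \<in> carrier D" for i j
    using assms M adjugate_W[of I J] by auto
  show "(\<Oplus>j\<in>J. A i j \<otimes> (h (row_adjugate I J j i') \<otimes> inv (M I J))) = (if i = i' then \<one> else \<zero>)"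
    if "i \<in> I" "i' \<in> I" for i i'
    using assms that by (rule right_inverse)
  fix j j' assume j: "j \<in> J" "j' \<in> J"
  have aW: "a i j' \<in> W" if "i \<in> I" for i
    using assms that j by (intro a_W) auto
  have "(\<Oplus>i\<in>I. h (row_adjugate I J j i) \<otimes> inv (M I J) \<otimes> A i j')
      = (\<Oplus>i\<in>I. inv (M I J) \<otimes> h (col_adjugate I J j i) \<otimes> A i j')"
    using assms j aW M adjugate_W[of I J] by (intro D.finsum_cong' refl) (auto simp: Pi_def adjugates_agree)
  also have "\<dots> = (if j = j' then \<one> else \<zero>)"
    using assms j by (rule left_inverse)
  finally show "(\<Oplus>i\<in>I. h (row_adjugate I J j i) \<otimes> inv (M I J) \<otimes> A i j') = (if j = j' then \<one> else \<zero>)" .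
qed

lemma matrix_inverse_unique:
  assumes "I \<subseteq> S" "J \<subseteq> S" "is_matrix_inverse D I J A Y" "is_matrix_inverse D I J A Y'" "i \<in> I" "j \<in> J"
  shows "Y j i = Y' j i"
proof (rule D.left_matrix_inverse_eq_right_inverse[of I J A])
  show "finite I" "finite J"
    using assms finite_subset_S by auto
  fix i j assume ij: "i \<in> I" "j \<in> J"
  show "A i j \<in> carrier D"
    using assms ij by (intro h_closed a_W) auto
qed (use assms in \<open>auto simp: is_matrix_inverse_def\<close>)

text \<open>The \<open>(j, i)\<close> entry of the inverse is the complementary minor over \<open>[I, J]\<close>, up to the weights of the
  expansion, and it is nonzero because minors are. For a submatrix of size one the formula also holds,
  as the empty minor is \<open>1\<close>.\<close>

lemma quasidet_eq:
  assumes "I \<subseteq> S" "J \<subseteq> S" "card I = card J" "i \<in> I" "j \<in> J"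
  shows "quasidet_defined D I J A i j"
    and "quasidet D I J A i j =
      h (C (index_weight row_twist i (I - {i}) / index_weight row_twist j (J - {j})))
        \<otimes> (M I J \<otimes> inv (M (I - {i}) (J - {j})))"
proof -
  let ?Y = "\<lambda>j i. h (row_adjugate I J j i) \<otimes> inv (M I J)"
  let ?z = "index_weight row_twist j (J - {j}) / index_weight row_twist i (I - {i})"
  let ?m = "M (I - {i}) (J - {j})"
  let ?x = "h (C (1 / ?z)) \<otimes> (M I J \<otimes> inv ?m)"
  have nz: "?z \<noteq> 0"
    using index_weight_nz[of i "I - {i}"] index_weight_nz[of j "J - {j}"] assms by auto
  have fin: "finite I" "finite J"
    using assms finite_subset_S by auto
  have W: "row_minor I J \<in> W" "row_minor (I - {i}) (J - {j}) \<in> W"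
    using assms by (auto intro!: row_minor_W)
  have M: "M I J \<in> Units D" and m: "?m \<in> Units D"
    using assms fin by (auto intro!: M_unit)
  have cl: "M I J \<in> carrier D" "?m \<in> carrier D" "inv (M I J) \<in> carrier D" "inv ?m \<in> carrier D"
    "h (C z) \<in> carrier D" for z
    using M m by auto
  have y: "?Y j i = ?m \<otimes> h (C ?z) \<otimes> inv (M I J)"
    using W by (simp add: row_adjugate_def C_left(1)[symmetric] h_mult)
  have scM: "M I J \<otimes> h (C z) = h (C z) \<otimes> M I J" for z
    using W C_left(1)[of "row_minor I J" z] by (simp flip: h_mult)
  have sc1: "h (C (1 / ?z)) \<otimes> h (C ?z) = \<one>"
    using nz by (simp flip: h_mult free_scalar_mult)
  have xy: "?x \<otimes> ?Y j i = \<one>"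
  proof -
    have "?x \<otimes> ?Y j i = h (C (1 / ?z)) \<otimes> (M I J \<otimes> (inv ?m \<otimes> ?m) \<otimes> h (C ?z)) \<otimes> inv (M I J)"
      unfolding y using cl by (simp add: D.m_assoc)
    also have "\<dots> = h (C (1 / ?z)) \<otimes> (M I J \<otimes> h (C ?z)) \<otimes> inv (M I J)"
      by (simp only: D.Units_l_inv[OF m] D.r_one[OF cl(1)])
    also have "\<dots> = (h (C (1 / ?z)) \<otimes> h (C ?z)) \<otimes> (M I J \<otimes> inv (M I J))"
      unfolding scM using cl by (simp only: D.m_assoc D.m_closed)
    also have "\<dots> = \<one>"
      using M by (simp only: sc1 D.Units_r_inv D.l_one D.one_closed)
    finally show ?thesis .
  qed
  have Yc: "?Y j i \<in> carrier D" and xc: "?x \<in> carrier D"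
    unfolding y using cl by auto
  have "?Y j i \<noteq> \<zero>"
  proof
    assume "?Y j i = \<zero>"
    then have "\<one> = \<zero>"
      using xy D.r_null[OF xc] by simp
    then show False
      using skew by (simp add: skew_field_def)
  qed
  then have Yu: "?Y j i \<in> Units D"
    using Yc by (simp add: units_iff)
  show "quasidet_defined D I J A i j"
    unfolding quasidet_defined_def using matrix_inverse[OF assms(1-3)] Yu by blast
  have "?x = ?x \<otimes> (?Y j i \<otimes> inv (?Y j i))"
    by (simp only: D.Units_r_inv[OF Yu] D.r_one[OF xc])
  also have "\<dots> = (?x \<otimes> ?Y j i) \<otimes> inv (?Y j i)"
    by (rule D.m_assoc[symmetric, OF xc Yc D.Units_inv_closed[OF Yu]])
  also have "\<dots> = inv (?Y j i)"
    by (simp only: xy D.l_one[OF D.Units_inv_closed[OF Yu]])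
  finally have "?x = inv (?Y j i)" .
  moreover have "1 / ?z = index_weight row_twist i (I - {i}) / index_weight row_twist j (J - {j})"
    by simp
  ultimately have inv: "inv (?Y j i) = h (C (index_weight row_twist i (I - {i}) / index_weight row_twist j (J - {j})))
        \<otimes> (M I J \<otimes> inv ?m)"
    by simp
  show "quasidet D I J A i j = h (C (index_weight row_twist i (I - {i}) / index_weight row_twist j (J - {j})))
        \<otimes> (M I J \<otimes> inv ?m)"
  proof (cases "I = {i} \<and> J = {j}")
    case True
    have "row_minor {i} {j} = a i j" "row_minor {} {} = 1"
      by (simp_all add: row_minor_def row.minor_Cons row.minor_Nil row.X_def index_weight_def)
    then show ?thesis
      using True assms a_W by (simp add: quasidet_def index_weight_def)
  next
    case False
    have "is_matrix_inverse D I J A (SOME Y. is_matrix_inverse D I J A Y)"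
      using matrix_inverse[OF assms(1-3)] by (rule someI[of "is_matrix_inverse D I J A"])
    from matrix_inverse_unique[OF assms(1,2) this matrix_inverse[OF assms(1-3)] assms(4,5)]
    have "(SOME Y. is_matrix_inverse D I J A Y) j i = ?Y j i" .
    then show ?thesis
      using False inv by (auto simp: quasidet_def)
  qed
qed

section \<open>Commutation of principal minors\<close>

text \<open>The \<open>(j, i)\<close> entry of the column adjugate of a principal submatrix is \<open>rescaling I i / rescaling I j\<close>
  times that of the row adjugate.\<close>

definition rescaling :: "nat set \<Rightarrow> nat \<Rightarrow> complex" where
  "rescaling I i = index_weight col_twist i (I - {i}) * index_weight row_twist i (I - {i})"

lemma rescaling_nz: "I \<subseteq> S \<Longrightarrow> i \<in> I \<Longrightarrow> rescaling I i \<noteq> 0"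
  using index_weight_nz[of i "I - {i}"] by (auto simp: rescaling_def)

lemma col_adjugate_eq:
  assumes "I \<subseteq> S" "i \<in> I" "j \<in> I"
  shows "col_adjugate I I j i = C (rescaling I i / rescaling I j) * row_adjugate I I j i"
proof -
  have "index_weight row_twist i (I - {i}) \<noteq> 0" "index_weight row_twist j (I - {j}) \<noteq> 0"
    using index_weight_nz(1)[of i "I - {i}"] index_weight_nz(1)[of j "I - {j}"] assms by auto
  then show ?thesis
    by (simp add: col_adjugate_def row_adjugate_def rescaling_def free_scalar_mult_left)
qed

text \<open>Put \<open>g = [I, I]\<close>. Writing the inverse of the submatrix as \<open>g\<inverse> Q\<close> with the column adjugate \<open>Q\<close>, which is a
  rescaling of the row adjugate \<open>P\<close>, the relation \<open>\<Sum>\<^sub>j a\<^sub>i\<^sub>j P\<^sub>j\<^sub>i\<^sub>' = \<delta> g\<close> shows that the matrix with entries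
  \<open>(r\<^sub>j / r\<^sub>i) g\<inverse> a\<^sub>i\<^sub>j g\<close> inverts that inverse as well. So it is the submatrix itself.\<close>

lemma principal_minor_twisted_commute:
  assumes "I \<subseteq> S" "i \<in> I" "j \<in> I"
  shows "row_minor I I * a i j \<approx> C (1 / rescaling I i * rescaling I j) * (a i j * row_minor I I)"
proof -
  let ?g = "row_minor I I" and ?r = "rescaling I"
  let ?L = "\<lambda>i j. inv (M I I) \<otimes> h (C (?r j / ?r i) * (a i j * ?g))"
  have fin: "finite I"
    using assms finite_subset_S by auto
  have M: "M I I \<in> Units D"
    using assms by (intro M_unit) auto
  have gW: "?g \<in> W"
    using assms by (intro row_minor_W)
  have aW: "a i j \<in> W" if "i \<in> I" "j \<in> I" for i j
    using assms that by (intro a_W) auto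
  have adjW: "row_adjugate I I j i \<in> W" "col_adjugate I I j i \<in> W" for i j
    using assms adjugate_W by auto
  have "?L i j = A i j"
  proof (rule D.left_matrix_inverse_eq_right_inverse[of I I "\<lambda>j i. inv (M I I) \<otimes> h (col_adjugate I I j i)" ?L A])
    fix i i' assume i: "i \<in> I" "i' \<in> I"
    have "?L i j \<otimes> (inv (M I I) \<otimes> h (col_adjugate I I j i'))
        = inv (M I I) \<otimes> h (C (?r i' / ?r i) * (a i j * row_adjugate I I j i'))" if j: "j \<in> I" for j
    proof -
      have "?L i j \<otimes> (inv (M I I) \<otimes> h (col_adjugate I I j i'))
          = inv (M I I) \<otimes> h (C (?r j / ?r i) * a i j) \<otimes> (M I I \<otimes> inv (M I I)) \<otimes> h (col_adjugate I I j i')"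
        using M gW aW[OF i(1) j] adjW by (simp add: h_mult mult_W D.m_assoc del: D.Units_r_inv)
      also have "\<dots> = inv (M I I) \<otimes> h (C (?r j / ?r i) * a i j * col_adjugate I I j i')"
        using M gW aW[OF i(1) j] adjW by (simp add: h_mult mult_W D.m_assoc)
      also have "C (?r j / ?r i) * a i j * col_adjugate I I j i' = C (?r i' / ?r i) * (a i j * row_adjugate I I j i')"
        using assms i j rescaling_nz[of I] by (simp add: col_adjugate_eq mult.assoc C_left(2)[of "a i j"] free_scalar_mult_left)
      finally show ?thesis .
    qed
    then have "(\<Oplus>j\<in>I. ?L i j \<otimes> (inv (M I I) \<otimes> h (col_adjugate I I j i')))
        = (\<Oplus>j\<in>I. inv (M I I) \<otimes> h (C (?r i' / ?r i) * (a i j * row_adjugate I I j i')))"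
      using M aW[OF i(1)] adjW by (intro D.finsum_cong' refl) (auto simp: Pi_def mult_W)
    also have "\<dots> = inv (M I I) \<otimes> (\<Oplus>j\<in>I. h (C (?r i' / ?r i) * (a i j * row_adjugate I I j i')))"
      using M aW[OF i(1)] adjW fin by (intro D.finsum_rdistr[symmetric]) (auto simp: Pi_def mult_W)
    also have "(\<Oplus>j\<in>I. h (C (?r i' / ?r i) * (a i j * row_adjugate I I j i')))
        = h (C (?r i' / ?r i) * (\<Sum>j\<in>I. a i j * row_adjugate I I j i'))"
      unfolding sum_distrib_left using aW[OF i(1)] adjW by (intro h_sum[symmetric] mult_W C_W)
    also have "\<dots> = h (C (?r i' / ?r i) * (if i = i' then ?g else 0))"
    proof (subst cong_iff[symmetric])
      show "C (?r i' / ?r i) * (\<Sum>j\<in>I. a i j * row_adjugate I I j i') \<in> W"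
        using aW[OF i(1)] adjW by (intro mult_W C_W free.subspace_sum[OF subspace_W])
      show "C (?r i' / ?r i) * (if i = i' then ?g else 0) \<in> W"
        using gW free.subspace_0[OF subspace_W] by (auto intro: mult_W)
      show "C (?r i' / ?r i) * (\<Sum>j\<in>I. a i j * row_adjugate I I j i')
          \<approx> C (?r i' / ?r i) * (if i = i' then ?g else 0)"
        using assms i by (intro cong_scalar matrix_mult_row_adjugate)
    qed
    finally show "(\<Oplus>j\<in>I. ?L i j \<otimes> (inv (M I I) \<otimes> h (col_adjugate I I j i'))) = (if i = i' then \<one> else \<zero>)"
      using M rescaling_nz[OF assms(1) i(1)] by auto
  next
    fix j j' assume "j \<in> I" "j' \<in> I"
    then show "(\<Oplus>i\<in>I. inv (M I I) \<otimes> h (col_adjugate I I j i) \<otimes> A i j') = (if j = j' then \<one> else \<zero>)"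
      using left_inverse[of I I j j'] assms by simp
  qed (use assms fin M gW aW adjW in \<open>auto simp: mult_W\<close>)
  then have "M I I \<otimes> A i j = M I I \<otimes> (inv (M I I) \<otimes> h (C (?r j / ?r i) * (a i j * ?g)))"
    by simp
  also have "\<dots> = h (C (?r j / ?r i) * (a i j * ?g))"
    using M aW[OF assms(2,3)] gW by (simp add: mult_W flip: D.m_assoc)
  finally have "h (?g * a i j) = h (C (1 / ?r i * ?r j) * (a i j * ?g))"
    using gW aW[OF assms(2,3)] by (simp add: h_mult)
  then show ?thesis
    using gW aW[OF assms(2,3)] by (subst cong_iff) (auto intro: mult_W)
qed

text \<open>In a principal minor every index occurs once as a row and once as a column, so the scalars
  \<open>r\<^sub>j / r\<^sub>i\<close> cancel.\<close>

lemma principal_minors_commute: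
  assumes "K \<subseteq> I" "I \<subseteq> S"
  shows "M I I \<otimes> M K K = M K K \<otimes> M I I"
proof -
  let ?r = "rescaling I"
  have W: "row_minor I I \<in> W" "row_minor K K \<in> W"
    using assms by (auto intro!: row_minor_W)
  have "row_minor I I * row_minor K K \<approx> C (prod (\<lambda>i. 1 / ?r i) K * prod ?r K) * (row_minor K K * row_minor I I)"
  proof (rule row_minor_twisted_commute[OF W(1)])
    fix i j assume "i \<in> K" "j \<in> K"
    then show "row_minor I I * a i j \<approx> C (1 / ?r i * ?r j) * (a i j * row_minor I I)"
      using assms by (intro principal_minor_twisted_commute) auto
  qed (use assms in auto)
  also have "prod (\<lambda>i. 1 / ?r i) K * prod ?r K = 1"
    unfolding prod.distrib[symmetric]
    by (rule prod.neutral) (use rescaling_nz[of I] assms in auto)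
  finally have "row_minor I I * row_minor K K \<approx> row_minor K K * row_minor I I"
    by simp
  then show ?thesis
    using W by (simp add: cong_iff mult_W flip: h_mult)
qed

section \<open>Telescoping products of quasi-minors\<close>

lemma telescoping_product:
  assumes G: "\<And>k. k \<in> {m..Suc n} \<Longrightarrow> G k \<in> W \<and> h (G k) \<in> Units D" and "G (Suc n) = 1" "m \<le> Suc n"
  shows "foldr (mult D) (map (\<lambda>k. h (C (z k)) \<otimes> (h (G k) \<otimes> inv (h (G (Suc k))))) [m..<Suc n]) \<one>
    = h (C (\<Prod>k\<in>{m..n}. z k) * G m)"
  using assms(3,1)
proof (induction m rule: inc_induct)
  case base
  then show ?case using assms(2) by simp
next
  case (step m)
  let ?z = "\<Prod>k\<in>{Suc m..n}. z k"
  have mn: "m \<le> n" using step by simp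
  then have upt: "[m..<Suc n] = m # [Suc m..<Suc n]" and int: "{m..n} = insert m {Suc m..n}"
    by (auto simp: upt_conv_Cons simp del: upt_Suc)
  have G: "G m \<in> W" "G (Suc m) \<in> W" "h (G (Suc m)) \<in> Units D"
    using step.prems[of m] step.prems[of "Suc m"] mn by auto
  have "foldr (mult D) (map (\<lambda>k. h (C (z k)) \<otimes> (h (G k) \<otimes> inv (h (G (Suc k))))) [m..<Suc n]) \<one>
    = h (C (z m)) \<otimes> (h (G m) \<otimes> inv (h (G (Suc m)))) \<otimes> h (C ?z * G (Suc m))"
    unfolding upt using step.IH step.prems by (simp del: upt_Suc)
  also have "h (C ?z * G (Suc m)) = h (G (Suc m)) \<otimes> h (C ?z)"
    unfolding C_left(1)[symmetric] using G by (simp add: h_mult)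
  also have "h (C (z m)) \<otimes> (h (G m) \<otimes> inv (h (G (Suc m)))) \<otimes> (h (G (Suc m)) \<otimes> h (C ?z))
      = h (C (z m)) \<otimes> (h (G m) \<otimes> (inv (h (G (Suc m))) \<otimes> h (G (Suc m))) \<otimes> h (C ?z))"
    using G by (simp add: D.m_assoc del: D.Units_l_inv)
  also have "\<dots> = h (C (z m)) \<otimes> (h (G m) \<otimes> h (C ?z))"
    using G by simp
  also have "\<dots> = h (C (z m) * (C ?z * G m))"
    using G C_left(1)[of "G m" ?z] by (simp add: mult_W flip: h_mult)
  also have "C (z m) * (C ?z * G m) = C (\<Prod>k\<in>{m..n}. z k) * G m"
    unfolding int by (simp add: free_scalar_mult_left)
  finally show ?case .
qed

text \<open>The rows (or columns) that are left when the \<open>k\<close>-th quasi-minor is taken.\<close>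

definition remaining :: "(nat \<Rightarrow> nat) \<Rightarrow> nat \<Rightarrow> nat set" where
  "remaining \<sigma> k = {1..n} - \<sigma> ` {1..<k}"

lemma remaining_eq:
  assumes "\<sigma> permutes {1..n}" "1 \<le> k"
  shows "remaining \<sigma> k = \<sigma> ` {k..n}"
proof -
  have "{1..n} - {1..<k} = {k..n}"
    using assms(2) by auto
  then show ?thesis
    unfolding remaining_def
    by (metis assms(1) image_set_diff permutes_image permutes_inj)
qed

lemma remaining_props:
  assumes "\<sigma> permutes {1..n}" "k \<in> {1..n}"
  shows "remaining \<sigma> k \<subseteq> S" "\<sigma> k \<in> remaining \<sigma> k" "card (remaining \<sigma> k) = Suc n - k"
    and "remaining \<sigma> k - {\<sigma> k} = remaining \<sigma> (Suc k)"
    and "remaining \<sigma> (Suc k) = \<sigma> ` {k<..n}"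
proof -
  have k: "1 \<le> k" "k \<le> n" using assms by auto
  show "remaining \<sigma> k \<subseteq> S" by (auto simp: remaining_def S_def)
  show "\<sigma> k \<in> remaining \<sigma> k" using k by (simp add: remaining_eq[OF assms(1)])
  show "card (remaining \<sigma> k) = Suc n - k"
    using k card_image[OF permutes_inj_on[OF assms(1)]] by (simp add: remaining_eq[OF assms(1)])
  have "{1..<Suc k} = insert k {1..<k}" using k by auto
  then show "remaining \<sigma> k - {\<sigma> k} = remaining \<sigma> (Suc k)"
    unfolding remaining_def by auto
  have "{Suc k..n} = {k<..n}" by auto
  then show "remaining \<sigma> (Suc k) = \<sigma> ` {k<..n}"
    by (simp add: remaining_eq[OF assms(1)])
qed

lemma quasi_minor_eq:
  assumes "\<sigma> permutes {1..n}" "\<tau> permutes {1..n}" "k \<in> {1..n}"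
  shows "quasi_minor_defined D n A \<sigma> \<tau> k"
    and "quasi_minor D n A \<sigma> \<tau> k =
      h (C (index_weight row_twist (\<sigma> k) (\<sigma> ` {k<..n}) / index_weight row_twist (\<tau> k) (\<tau> ` {k<..n})))
      \<otimes> (M (remaining \<sigma> k) (remaining \<tau> k) \<otimes> inv (M (remaining \<sigma> (Suc k)) (remaining \<tau> (Suc k))))"
proof -
  note \<sigma> = remaining_props[OF assms(1,3)] and \<tau> = remaining_props[OF assms(2,3)]
  have "card (remaining \<sigma> k) = card (remaining \<tau> k)"
    by (simp add: \<sigma>(3) \<tau>(3))
  note quasidet_eq = quasidet_eq[OF \<sigma>(1) \<tau>(1) this \<sigma>(2) \<tau>(2)]
  show "quasi_minor_defined D n A \<sigma> \<tau> k"
    using quasidet_eq(1) by (simp only: quasi_minor_defined_def remaining_def)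
  show "quasi_minor D n A \<sigma> \<tau> k =
      h (C (index_weight row_twist (\<sigma> k) (\<sigma> ` {k<..n}) / index_weight row_twist (\<tau> k) (\<tau> ` {k<..n})))
      \<otimes> (M (remaining \<sigma> k) (remaining \<tau> k) \<otimes> inv (M (remaining \<sigma> (Suc k)) (remaining \<tau> (Suc k))))"
    unfolding quasi_minor_def remaining_def[symmetric] quasidet_eq(2) \<sigma>(4) \<tau>(4) \<sigma>(5)[symmetric] \<tau>(5)[symmetric] ..
qed

lemma remaining_minor:
  assumes "\<sigma> permutes {1..n}" "\<tau> permutes {1..n}" "k \<in> {1..Suc n}"
  shows "row_minor (remaining \<sigma> k) (remaining \<tau> k) \<in> W \<and> M (remaining \<sigma> k) (remaining \<tau> k) \<in> Units D"
proof -
  have S: "remaining \<sigma> k \<subseteq> S" "remaining \<tau> k \<subseteq> S"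
    by (auto simp: remaining_def S_def)
  have "card (remaining \<sigma> k) = card {k..n}" "card (remaining \<tau> k) = card {k..n}"
    using assms by (simp_all add: remaining_eq card_image permutes_inj_on)
  then show ?thesis
    using S row_minor_W M_unit by simp
qed

lemma neg_weight_nz:
  assumes "\<sigma> permutes {1..n}"
  shows "neg_weight n q \<sigma> \<noteq> 0"
proof -
  have "index_weight row_twist (\<sigma> k) (\<sigma> ` {k<..n}) \<noteq> 0" if "k \<in> {1..n}" for k
    using remaining_props(1,2)[OF assms that] remaining_props(4,5)[OF assms that]
    by (intro index_weight_nz) auto
  then show ?thesis
    unfolding neg_weight_eq_index_weights[OF assms] by (simp add: prod_zero_iff)
qed

text \<open>The weight in the \<open>k\<close>-th factor is that of \<open>\<sigma> k\<close> against the rows \<open>\<sigma> l\<close>, \<open>l > k\<close>, which are still there, and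
  likewise for \<open>\<tau>\<close>. Over all \<open>k\<close> these weights run through the inversions, which gives \<open>(-q)\<^sub>\<sigma> / (-q)\<^sub>\<tau>\<close>.\<close>

lemma product_of_quasi_minors:
  assumes "\<sigma> permutes {1..n}" "\<tau> permutes {1..n}"
  shows "ordered_prod D n (quasi_minor D n A \<sigma> \<tau>)
    = h (C (neg_weight n q \<sigma> / neg_weight n q \<tau>) * row_minor S S)"
proof -
  let ?z = "\<lambda>k. index_weight row_twist (\<sigma> k) (\<sigma> ` {k<..n}) / index_weight row_twist (\<tau> k) (\<tau> ` {k<..n})"
  let ?G = "\<lambda>k. row_minor (remaining \<sigma> k) (remaining \<tau> k)"
  have "ordered_prod D n (quasi_minor D n A \<sigma> \<tau>) =
     foldr (mult D) (map (\<lambda>k. h (C (?z k)) \<otimes> (h (?G k) \<otimes> inv (h (?G (Suc k))))) [1..<Suc n]) \<one>"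
    unfolding ordered_prod_def
    by (rule arg_cong[where f = "\<lambda>xs. foldr (mult D) xs \<one>"])
      (use quasi_minor_eq(2)[OF assms] in \<open>auto simp del: upt_Suc\<close>)
  also have "\<dots> = h (C (\<Prod>k\<in>{1..n}. ?z k) * ?G 1)"
  proof (rule telescoping_product)
    show "?G (Suc n) = 1"
      using assms by (simp add: remaining_eq row_minor_def row.minor_Nil)
  qed (use remaining_minor[OF assms] in auto)
  also have "(\<Prod>k\<in>{1..n}. ?z k) = neg_weight n q \<sigma> / neg_weight n q \<tau>"
    using assms by (simp add: neg_weight_eq_index_weights prod_dividef)
  also have "?G 1 = row_minor S S"
    by (simp add: remaining_def S_def)
  finally show ?thesis .
qed

text \<open>For \<open>\<sigma> = \<tau> = id\<close> the \<open>k\<close>-th quasi-minor is the quotient of the principal minors on \<open>{k..n}\<close> and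
  \<open>{k+1..n}\<close>, and these index sets form a chain.\<close>

lemma quasi_minors_commute:
  assumes "k \<in> {1..n}" "l \<in> {1..n}"
  shows "quasi_minor D n A id id k \<otimes> quasi_minor D n A id id l
      = quasi_minor D n A id id l \<otimes> quasi_minor D n A id id k"
proof -
  let ?m = "\<lambda>k. M {k..n} {k..n}"
  have m: "?m k \<in> Units D" if "1 \<le> k" for k
    using that by (intro M_unit) (auto simp: S_def)
  have mc: "?m k \<otimes> inv (?m (Suc k)) \<in> carrier D" if "1 \<le> k" for k
    using m[of k] m[of "Suc k"] that by auto
  have eq: "quasi_minor D n A id id k = ?m k \<otimes> inv (?m (Suc k))" if "k \<in> {1..n}" for k
  proof -
    have "{k<..n} \<subseteq> S" "k \<in> S" using that by (auto simp: S_def)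
    then have "index_weight row_twist k {k<..n} \<noteq> 0"
      by (intro index_weight_nz)
    then show ?thesis
      using quasi_minor_eq(2)[OF permutes_id permutes_id that] mc[of k] that
        remaining_eq[OF permutes_id, of k] remaining_eq[OF permutes_id, of "Suc k"] by simp
  qed
  have comm: "?m k \<otimes> ?m l = ?m l \<otimes> ?m k" if "1 \<le> k" "1 \<le> l" for k l
  proof -
    have main: "?m k \<otimes> ?m l = ?m l \<otimes> ?m k" if "1 \<le> k" "k \<le> l" for k l
      by (rule principal_minors_commute) (use that in \<open>auto simp: S_def\<close>)
    show ?thesis
      using main[of k l] main[of l k] that by (cases "k \<le> l") auto
  qed
  have commi: "?m k \<otimes> inv (?m l) = inv (?m l) \<otimes> ?m k" if "1 \<le> k" "1 \<le> l" for k l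
    using m that comm by (intro D.commute_inv) auto
  have 1: "?m i \<otimes> (?m k \<otimes> inv (?m (Suc k))) = ?m k \<otimes> inv (?m (Suc k)) \<otimes> ?m i" if "1 \<le> i" "1 \<le> k" for i k
    using m that comm commi by (intro D.commute_mult) auto
  have 2: "?m k \<otimes> inv (?m (Suc k)) \<otimes> inv (?m i) = inv (?m i) \<otimes> (?m k \<otimes> inv (?m (Suc k)))" if "1 \<le> i" "1 \<le> k" for i k
    using m that 1[OF that] mc by (intro D.commute_inv) auto
  show ?thesis
    unfolding eq[OF assms(1)] eq[OF assms(2)]
    using m mc assms 1[of l k] 2[of "Suc l" k] by (intro D.commute_mult) auto
qed

end

theorem theorem3p2:
  fixes n :: nat
    and p q :: "nat \<Rightarrow> nat \<Rightarrow> complex"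
    and lam :: complex
    and GL :: "'g ring"
    and D :: "'d ring"
    and \<phi> :: "((nat \<times> nat) free_word \<Rightarrow>\<^sub>0 complex) set \<Rightarrow> 'g"
    and \<psi> :: "'g \<Rightarrow> 'd"
  assumes "n \<ge> 1"
    and "p_lambda_condition n p q lam"
    and "is_GL n p q GL \<phi>"
    and "is_skew_field_of_fractions GL D \<psi>"
  shows "let A = (\<lambda>i j. \<psi> (\<phi> (qmat_gen n p q i j)));
             det = \<psi> (\<phi> (qdet n p q));
             scal = (\<lambda>c. \<psi> (\<phi> (qmat_scalar n p q c)))
         in
           (\<forall>k\<in>{1..n}. quasi_minor_defined D n A id id k) \<and>
           det = ordered_prod D n (quasi_minor D n A id id) \<and>
           (\<forall>k\<in>{1..n}. \<forall>l\<in>{1..n}.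
              quasi_minor D n A id id k \<otimes>\<^bsub>D\<^esub> quasi_minor D n A id id l
                = quasi_minor D n A id id l \<otimes>\<^bsub>D\<^esub> quasi_minor D n A id id k) \<and>
           (\<forall>\<sigma> \<tau>. \<sigma> permutes {1..n} \<longrightarrow> \<tau> permutes {1..n} \<longrightarrow>
              (\<forall>k\<in>{1..n}. quasi_minor_defined D n A \<sigma> \<tau> k) \<and>
              det = scal (neg_weight n q \<tau> / neg_weight n q \<sigma>) \<otimes>\<^bsub>D\<^esub>
                      ordered_prod D n (quasi_minor D n A \<sigma> \<tau>))"
proof -
  interpret quantum_matrix n p q lam
    using assms(2) by unfold_locales
  let ?Q = "qmat_algebra n p q"
  define \<pi> where "\<pi> f = qmat_ideal n p q +>\<^bsub>qmat_free n\<^esub> f" for f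
  define h where "h f = \<psi> (\<phi> (\<pi> f))" for f
  have \<pi>: "\<pi> \<in> ring_hom (qmat_free n) ?Q"
    unfolding \<pi>_def[abs_def] qmat_algebra_def by (rule N.rcos_ring_hom)
  have \<phi>: "ring GL" "\<phi> \<in> ring_hom ?Q GL" "inj_on \<phi> (carrier ?Q)"
    using assms(3) by (auto simp: is_GL_def ring_of_fractions_def)
  have \<psi>: "skew_field D" "\<psi> \<in> ring_hom GL D" "inj_on \<psi> (carrier GL)"
    using assms(4) by (auto simp: is_skew_field_of_fractions_def ring_of_fractions_def)
  interpret Q: ring ?Q
    unfolding qmat_algebra_def by (rule N.quotient_is_ring)
  interpret GL: ring GL
    by (rule \<phi>(1))
  interpret D': ring D
    using \<psi>(1) by (simp add: skew_field_def)
  have h_hom: "h \<in> ring_hom (qmat_free n) D"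
    using ring_hom_trans[OF ring_hom_trans[OF \<pi> \<phi>(2)] \<psi>(2)] by (simp add: h_def[abs_def] comp_def)
  have \<phi>0: "\<phi> \<zero>\<^bsub>?Q\<^esub> = \<zero>\<^bsub>GL\<^esub>" and \<psi>0: "\<psi> \<zero>\<^bsub>GL\<^esub> = \<zero>\<^bsub>D\<^esub>"
    using ring_hom_zero[OF \<phi>(2)] ring_hom_zero[OF \<psi>(2)] Q.ring_axioms GL.ring_axioms D'.ring_axioms by blast+
  have kernel: "h x = \<zero>\<^bsub>D\<^esub> \<longleftrightarrow> x \<in> N" if "x \<in> W" for x
  proof -
    have \<pi>x: "\<pi> x \<in> carrier ?Q"
      using ring_hom_closed[OF \<pi>] that by (simp add: W_def)
    then have "h x = \<zero>\<^bsub>D\<^esub> \<longleftrightarrow> \<phi> (\<pi> x) = \<zero>\<^bsub>GL\<^esub>"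
      using inj_onD[OF \<psi>(3), of "\<phi> (\<pi> x)" "\<zero>\<^bsub>GL\<^esub>"] ring_hom_closed[OF \<phi>(2)] \<psi>0 by (auto simp: h_def)
    also have "\<dots> \<longleftrightarrow> \<pi> x = \<zero>\<^bsub>?Q\<^esub>"
      using inj_onD[OF \<phi>(3), of "\<pi> x" "\<zero>\<^bsub>?Q\<^esub>"] \<pi>x \<phi>0 by auto
    also have "\<dots> \<longleftrightarrow> x \<in> N"
      using that N.rcos_const_imp_mem[of x] N.a_rcos_const[of x]
      by (auto simp: \<pi>_def qmat_algebra_def FactRing_def W_def)
    finally show ?thesis .
  qed
  interpret quantum_fractions n p q lam D h
    by unfold_locales (use \<psi>(1) h_hom kernel in auto)
  have A: "\<psi> (\<phi> (qmat_gen n p q i j)) = A i j" for i j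
    by (simp add: h_def \<pi>_def qmat_gen_def)
  have scal: "\<psi> (\<phi> (qmat_scalar n p q c)) = h (C c)" for c
    by (simp add: h_def \<pi>_def qmat_scalar_def)
  have det: "\<psi> (\<phi> (qdet n p q)) = M S S"
  proof -
    have "\<pi> (row_minor S S) = qdet n p q"
      unfolding \<pi>_def by (rule coset_of_full_minor)
    then show ?thesis
      by (simp add: h_def)
  qed
  have SW: "row_minor S S \<in> W"
    by (rule row_minor_W) auto
  have main: "M S S = h (C (neg_weight n q \<tau> / neg_weight n q \<sigma>)) \<otimes>\<^bsub>D\<^esub> ordered_prod D n (quasi_minor D n A \<sigma> \<tau>)"
    if "\<sigma> permutes {1..n}" "\<tau> permutes {1..n}" for \<sigma> \<tau>
    using SW neg_weight_nz[OF that(1)] neg_weight_nz[OF that(2)]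
    by (simp add: product_of_quasi_minors[OF that] free_scalar_mult_left mult_W flip: h_mult)
  have id: "M S S = ordered_prod D n (quasi_minor D n A id id)"
    using neg_weight_nz[OF permutes_id] by (simp add: product_of_quasi_minors[OF permutes_id permutes_id])
  show ?thesis
    unfolding Let_def A scal det
  proof (intro conjI ballI allI impI)
    show "quasi_minor_defined D n A id id k" if "k \<in> {1..n}" for k
      using that by (rule quasi_minor_eq(1)[OF permutes_id permutes_id])
  qed (rule id quasi_minors_commute quasi_minor_eq(1) main; assumption)+
qed

end
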